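(* Let $F$ be a field of characteristic zero and $W$ a unital $\mathbb{Z}_2$-graded $F$-algebra. Let $UT_2^D$ be the $\mathbb{Z}_2$-graded $W$-algebra of $2\times2$ upper triangular matrices over $F$ with the canonical grading, where $W$ acts as the algebra $D=Fe_{11}\oplus Fe_{22}$ by left and right multiplication. Fix the ordered basis $\{w_i\}_{i\in\mathcal I}$ of $W$ so that $w_0=1_W$ and $w_1$ act as left and right multiplication by $1$ and $e_{22}$ respectively, and $w_j$ acts as zero for all $j\ge2$. Then $\mathrm{Id}^{\mathbb{Z}_2,W}(UT_2^D)$ is generated, as a $T_{\mathbb{Z}_2,W}$-ideal, by the polynomials $$[y_1,y_2],\quad w_1y-yw_1,\quad zw_1-z,\quad w_iz,\quad zw_j,\quad w_jy,\quad yw_j$$ for all $i\ge1$, $j\ge2$. Moreover, for all $n\ge1$, $c_n^{\mathbb{Z}_2,W}(UT_2^D)=n2^{n-1}+2$.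
   Context: The canonical grading is $UT_2^0=Fe_{11}\oplus Fe_{22}$, $UT_2^1=Fe_{12}$. "$W$ acts as a unital graded subalgebra $B\subseteq UT_2$ by left and right multiplication" means there is a surjective unital graded homomorphism $\varphi:W\to B$ with $wa=\varphi(w)a$, $aw=a\varphi(w)$; here $B=D$, and $\varphi(w_0)=1$, $\varphi(w_1)=e_{22}$, $\varphi(w_j)=0$ for $j\ge2$ (i.e. for all remaining indices). $[a,b]=ab-ba$. Let $y_1,y_2,\dots$ be variables of degree $0$ and $z_1,z_2,\dots$ of degree $1$ ($y,z$ denote one such variable). The free $\mathbb{Z}_2$-graded $W$-algebra $W\langle Y,Z\rangle$ has vector space basis the monomials $w_{i_0}u_1w_{i_1}\cdots w_{i_{n-1}}u_nw_{i_n}$, $n\ge1$, each $u_j$ a variable; product is juxtaposition followed by multiplication in $W$, $W$ acts by multiplication at the two ends, a variable $x$ is identified with $1_Wx1_W$, and for homogeneous elements of $W$ the degree of a monomial is the sum of the degrees of its factors. $\mathrm{Id}^{\mathbb{Z}_2,W}(A)$ is the set of elements vanishing under all substitutions of $y$'s by elements of $A^0$ and $z$'s by elements of $A^1$. A $T_{\mathbb{Z}_2,W}$-ideal is a two-sided ideal, closed under the left and right $W$-action, invariant under all graded $W$-algebra endomorphisms of $W\langle Y,Z\rangle$. $P_n^{\mathbb{Z}_2,W}$ is the span of all monomials $w_{i_0}u_{\sigma(1)}w_{i_1}\cdots u_{\sigma(n)}w_{i_n}$ with $\sigma\in S_n$, each $u_i\in\{y_i,z_i\}$, and $c_n^{\mathbb{Z}_2,W}(A)=\dim_F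 P_n^{\mathbb{Z}_2,W}/(P_n^{\mathbb{Z}_2,W}\cap\mathrm{Id}^{\mathbb{Z}_2,W}(A))$. *)

theory Defs
  imports
    "HOL-Analysis.Finite_Cartesian_Product"
    "HOL-Combinatorics.Permutations"
    "HOL-Library.Poly_Mapping"
    "HOL-Library.Z2"
begin

section \<open>Graded algebras\<close>

text \<open>The group of degrees is the two-element field \<^typ>\<open>bit\<close>.\<close>

locale z2_graded_algebra = vector_space sW
  for sW :: "'f::field \<Rightarrow> 'w::ring_1 \<Rightarrow> 'w" +
  fixes gr :: "bit \<Rightarrow> 'w set"
  assumes scale_mult_left: "sW c (x * y) = sW c x * y"
    and scale_mult_right: "sW c (x * y) = x * sW c y"
    and gr_subspace: "subspace (gr g)"
    and gr_sum: "\<exists>u\<in>gr 0. \<exists>v\<in>gr 1. w = u + v"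
    and gr_direct: "gr 0 \<inter> gr 1 = {0}"
    and gr_mult: "x \<in> gr g \<Longrightarrow> y \<in> gr h \<Longrightarrow> x * y \<in> gr (g + h)"

definition indexed_basis :: "('f::field \<Rightarrow> 'w::ab_group_add \<Rightarrow> 'w) \<Rightarrow> ('i \<Rightarrow> 'w) \<Rightarrow> bool" where
  "indexed_basis sW w \<longleftrightarrow>
     inj w \<and> \<not> module.dependent sW (range w) \<and> module.span sW (range w) = UNIV"

definition coord ::
    "('f::field \<Rightarrow> 'w::ab_group_add \<Rightarrow> 'w) \<Rightarrow> ('i \<Rightarrow> 'w) \<Rightarrow> 'i \<Rightarrow> 'w \<Rightarrow> 'f" where
  "coord sW w k v = module.representation sW (range w) v (w k)"


section \<open>Upper triangular matrices\<close>

definition mscale :: "'f::field \<Rightarrow> 'f^2^2 \<Rightarrow> 'f^2^2" where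
  "mscale c = map_matrix ((*) c)"

definition E :: "2 \<Rightarrow> 2 \<Rightarrow> 'f::field^2^2" where
  "E i j = (\<chi> k l. if k = i \<and> l = j then 1 else 0)"

definition UT2 :: "('f::field^2^2) set" where
  "UT2 = {A. A $ 2 $ 1 = 0}"

definition D :: "('f::field^2^2) set" where
  "D = {mscale a (E 1 1) + mscale b (E 2 2) | a b. True}"

definition UT2_gr :: "bit \<Rightarrow> ('f::field^2^2) set" where
  "UT2_gr g = (if g = 0 then D else {mscale c (E 1 2) | c. True})"

definition unital_graded_hom_UT2 ::
    "('f::field \<Rightarrow> 'w::ring_1 \<Rightarrow> 'w) \<Rightarrow> (bit \<Rightarrow> 'w set) \<Rightarrow> ('w \<Rightarrow> 'f^2^2) \<Rightarrow> bool" where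
  "unital_graded_hom_UT2 sW gr \<phi> \<longleftrightarrow>
     (\<forall>x. \<phi> x \<in> UT2) \<and>
     (\<forall>x y. \<phi> (x + y) = \<phi> x + \<phi> y) \<and>
     (\<forall>c x. \<phi> (sW c x) = mscale c (\<phi> x)) \<and>
     (\<forall>x y. \<phi> (x * y) = \<phi> x ** \<phi> y) \<and>
     \<phi> 1 = mat 1 \<and>
     (\<forall>g. \<forall>x\<in>gr g. \<phi> x \<in> UT2_gr g)"


section \<open>The free graded algebra with an action of W\<close>

datatype var = Y nat | Z nat

fun var_deg :: "var \<Rightarrow> bit" where
  "var_deg (Y n) = 0"
| "var_deg (Z n) = 1"

text \<open>
  \<open>Unit i x j\<close> stands for the monomial \<open>w_i x w_j\<close>, and \<open>Step i x m\<close> for \<open>w_i x m\<close>. Hence the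
  elements of \<open>'i mono\<close> are the monomials \<open>w_{i_0} u_1 w_{i_1} \<dots> u_n w_{i_n}\<close> with \<open>n \<ge> 1\<close>, and the
  underlying vector space of the free algebra is \<open>'i mono \<Rightarrow>\<^sub>0 'f\<close>.
\<close>

datatype 'i mono = Unit 'i var 'i | Step 'i var "'i mono"

fun letters :: "'i mono \<Rightarrow> var list" where
  "letters (Unit i x j) = [x]"
| "letters (Step i x m) = x # letters m"

fun first_idx :: "'i mono \<Rightarrow> 'i" where
  "first_idx (Unit i x j) = i"
| "first_idx (Step i x m) = i"

fun last_idx :: "'i mono \<Rightarrow> 'i" where
  "last_idx (Unit i x j) = j"
| "last_idx (Step i x m) = last_idx m"

fun set_first :: "'i \<Rightarrow> 'i mono \<Rightarrow> 'i mono" where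
  "set_first k (Unit i x j) = Unit k x j"
| "set_first k (Step i x m) = Step k x m"

fun set_last :: "'i \<Rightarrow> 'i mono \<Rightarrow> 'i mono" where
  "set_last k (Unit i x j) = Unit i x k"
| "set_last k (Step i x m) = Step i x (set_last k m)"

text \<open>\<open>join m k m'\<close>: the last index of \<open>m\<close> and the first index of \<open>m'\<close> are replaced by a single \<open>k\<close>.\<close>

fun join :: "'i mono \<Rightarrow> 'i \<Rightarrow> 'i mono \<Rightarrow> 'i mono" where
  "join (Unit i x j) k m' = Step i x (set_first k m')"
| "join (Step i x m) k m' = Step i x (join m k m')"

definition fscale :: "'f::field \<Rightarrow> ('m \<Rightarrow>\<^sub>0 'f) \<Rightarrow> ('m \<Rightarrow>\<^sub>0 'f)" where
  "fscale c p = Poly_Mapping.map ((*) c) p"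

definition lin_ext ::
    "('f::field \<Rightarrow> 'a::ab_group_add \<Rightarrow> 'a) \<Rightarrow> ('m \<Rightarrow> 'a) \<Rightarrow> ('m \<Rightarrow>\<^sub>0 'f) \<Rightarrow> 'a" where
  "lin_ext sW f p =
     (\<Sum>m\<in>Poly_Mapping.keys p. sW (Poly_Mapping.lookup p m) (f m))"

text \<open>
  For \<open>v = \<Sum>k. v_k w_k\<close> in \<open>W\<close>, \<open>fill sW w h v\<close> is \<open>\<Sum>k. v_k (h k)\<close>, where \<open>h k\<close> is a monomial
  having the basis element \<open>w_k\<close> in a distinguished place; so it is that monomial with \<open>v\<close> in
  this place.
\<close>

definition fill ::
    "('f::field \<Rightarrow> 'w::ab_group_add \<Rightarrow> 'w) \<Rightarrow> ('i \<Rightarrow> 'w) \<Rightarrow> ('i \<Rightarrow> 'i mono) \<Rightarrow> 'w \<Rightarrow> ('i mono \<Rightarrow>\<^sub>0 'f)" where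
  "fill sW w h v =
     (\<Sum>k | coord sW w k v \<noteq> 0. Poly_Mapping.single (h k) (coord sW w k v))"

definition free_lact ::
    "('f::field \<Rightarrow> 'w::ring_1 \<Rightarrow> 'w) \<Rightarrow> ('i \<Rightarrow> 'w) \<Rightarrow> 'w \<Rightarrow> ('i mono \<Rightarrow>\<^sub>0 'f) \<Rightarrow> ('i mono \<Rightarrow>\<^sub>0 'f)" where
  "free_lact sW w v =
     lin_ext fscale (\<lambda>m. fill sW w (\<lambda>k. set_first k m) (v * w (first_idx m)))"

definition free_ract ::
    "('f::field \<Rightarrow> 'w::ring_1 \<Rightarrow> 'w) \<Rightarrow> ('i \<Rightarrow> 'w) \<Rightarrow> ('i mono \<Rightarrow>\<^sub>0 'f) \<Rightarrow> 'w \<Rightarrow> ('i mono \<Rightarrow>\<^sub>0 'f)" where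
  "free_ract sW w p v =
     lin_ext fscale (\<lambda>m. fill sW w (\<lambda>k. set_last k m) (w (last_idx m) * v)) p"

definition free_mult ::
    "('f::field \<Rightarrow> 'w::ring_1 \<Rightarrow> 'w) \<Rightarrow> ('i \<Rightarrow> 'w) \<Rightarrow>
       ('i mono \<Rightarrow>\<^sub>0 'f) \<Rightarrow> ('i mono \<Rightarrow>\<^sub>0 'f) \<Rightarrow> ('i mono \<Rightarrow>\<^sub>0 'f)" where
  "free_mult sW w p q =
     lin_ext fscale (\<lambda>m. lin_ext fscale (\<lambda>m'.
       fill sW w (\<lambda>k. join m k m') (w (last_idx m) * w (first_idx m'))) q) p"

text \<open>The element \<open>v x v'\<close> of the free algebra, for arbitrary \<open>v, v'\<close> in \<open>W\<close>.\<close>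

definition wxw ::
    "('f::field \<Rightarrow> 'w::ring_1 \<Rightarrow> 'w) \<Rightarrow> ('i \<Rightarrow> 'w) \<Rightarrow> 'w \<Rightarrow> var \<Rightarrow> 'w \<Rightarrow> ('i mono \<Rightarrow>\<^sub>0 'f)" where
  "wxw sW w v x v' =
     (\<Sum>i | coord sW w i v \<noteq> 0. fscale (coord sW w i v) (fill sW w (Unit i x) v'))"

definition var_elt ::
    "('f::field \<Rightarrow> 'w::ring_1 \<Rightarrow> 'w) \<Rightarrow> ('i \<Rightarrow> 'w) \<Rightarrow> var \<Rightarrow> ('i mono \<Rightarrow>\<^sub>0 'f)" where
  "var_elt sW w x = wxw sW w 1 x 1"

text \<open>
  \<open>hom_mono sW gr w g p\<close>: \<open>p = v_0 u_1 v_1 \<dots> u_n v_n\<close> with all \<open>v_k\<close> homogeneous elements of \<open>W\<close>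
  and degrees adding up to \<open>g\<close>. The basis \<open>w\<close> itself is not required to be homogeneous, so a
  basis monomial need not have a degree.
\<close>

inductive hom_mono ::
    "('f::field \<Rightarrow> 'w::ring_1 \<Rightarrow> 'w) \<Rightarrow> (bit \<Rightarrow> 'w set) \<Rightarrow> ('i \<Rightarrow> 'w) \<Rightarrow>
       bit \<Rightarrow> ('i mono \<Rightarrow>\<^sub>0 'f) \<Rightarrow> bool"
  for sW gr w where
  unit: "v \<in> gr g \<Longrightarrow> v' \<in> gr h \<Longrightarrow>
    hom_mono sW gr w (g + var_deg x + h) (wxw sW w v x v')"
| step: "v \<in> gr g \<Longrightarrow> hom_mono sW gr w h p \<Longrightarrow>
    hom_mono sW gr w (g + var_deg x + h) (free_mult sW w (wxw sW w v x 1) p)"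

definition free_gr ::
    "('f::field \<Rightarrow> 'w::ring_1 \<Rightarrow> 'w) \<Rightarrow> (bit \<Rightarrow> 'w set) \<Rightarrow> ('i \<Rightarrow> 'w) \<Rightarrow>
       bit \<Rightarrow> ('i mono \<Rightarrow>\<^sub>0 'f) set" where
  "free_gr sW gr w g = module.span fscale {p. hom_mono sW gr w g p}"


section \<open>T-ideals\<close>

definition graded_endo ::
    "('f::field \<Rightarrow> 'w::ring_1 \<Rightarrow> 'w) \<Rightarrow> (bit \<Rightarrow> 'w set) \<Rightarrow> ('i \<Rightarrow> 'w) \<Rightarrow>
       (('i mono \<Rightarrow>\<^sub>0 'f) \<Rightarrow> ('i mono \<Rightarrow>\<^sub>0 'f)) \<Rightarrow> bool" where
  "graded_endo sW gr w f \<longleftrightarrow>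
     (\<forall>p q. f (p + q) = f p + f q) \<and>
     (\<forall>c p. f (fscale c p) = fscale c (f p)) \<and>
     (\<forall>p q. f (free_mult sW w p q) = free_mult sW w (f p) (f q)) \<and>
     (\<forall>v p. f (free_lact sW w v p) = free_lact sW w v (f p)) \<and>
     (\<forall>v p. f (free_ract sW w p v) = free_ract sW w (f p) v) \<and>
     (\<forall>g. \<forall>p\<in>free_gr sW gr w g. f p \<in> free_gr sW gr w g)"

definition T_ideal ::
    "('f::field \<Rightarrow> 'w::ring_1 \<Rightarrow> 'w) \<Rightarrow> (bit \<Rightarrow> 'w set) \<Rightarrow> ('i \<Rightarrow> 'w) \<Rightarrow>
       ('i mono \<Rightarrow>\<^sub>0 'f) set \<Rightarrow> bool" where
  "T_ideal sW gr w I \<longleftrightarrow>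
     module.subspace fscale I \<and>
     (\<forall>p\<in>I. \<forall>q. free_mult sW w p q \<in> I \<and> free_mult sW w q p \<in> I) \<and>
     (\<forall>p\<in>I. \<forall>v. free_lact sW w v p \<in> I \<and> free_ract sW w p v \<in> I) \<and>
     (\<forall>f. graded_endo sW gr w f \<longrightarrow> f ` I \<subseteq> I)"

definition T_ideal_generated ::
    "('f::field \<Rightarrow> 'w::ring_1 \<Rightarrow> 'w) \<Rightarrow> (bit \<Rightarrow> 'w set) \<Rightarrow> ('i \<Rightarrow> 'w) \<Rightarrow>
       ('i mono \<Rightarrow>\<^sub>0 'f) set \<Rightarrow> ('i mono \<Rightarrow>\<^sub>0 'f) set" where
  "T_ideal_generated sW gr w S = \<Inter>{I. T_ideal sW gr w I \<and> S \<subseteq> I}"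


section \<open>Identities and codimensions\<close>

text \<open>
  A graded algebra with action of \<open>W\<close> is given by its operations and its homogeneous components:
  scalar multiplication \<open>s\<close>, product \<open>mul\<close>, left action \<open>l\<close>, right action \<open>r\<close>, grading \<open>A\<close>.
\<close>

fun eval_mono ::
    "('a \<Rightarrow> 'a \<Rightarrow> 'a) \<Rightarrow> ('w \<Rightarrow> 'a \<Rightarrow> 'a) \<Rightarrow> ('a \<Rightarrow> 'w \<Rightarrow> 'a) \<Rightarrow> ('i \<Rightarrow> 'w) \<Rightarrow>
       (var \<Rightarrow> 'a) \<Rightarrow> 'i mono \<Rightarrow> 'a" where
  "eval_mono mul l r w \<sigma> (Unit i x j) = r (l (w i) (\<sigma> x)) (w j)"
| "eval_mono mul l r w \<sigma> (Step i x m) = mul (l (w i) (\<sigma> x)) (eval_mono mul l r w \<sigma> m)"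

definition graded_identities ::
    "('f::field \<Rightarrow> 'a::ab_group_add \<Rightarrow> 'a) \<Rightarrow> ('a \<Rightarrow> 'a \<Rightarrow> 'a) \<Rightarrow> ('w \<Rightarrow> 'a \<Rightarrow> 'a) \<Rightarrow>
       ('a \<Rightarrow> 'w \<Rightarrow> 'a) \<Rightarrow> (bit \<Rightarrow> 'a set) \<Rightarrow> ('i \<Rightarrow> 'w) \<Rightarrow> ('i mono \<Rightarrow>\<^sub>0 'f) set" where
  "graded_identities s mul l r A w =
     {p. \<forall>\<sigma>. (\<forall>x. \<sigma> x \<in> A (var_deg x)) \<longrightarrow> lin_ext s (eval_mono mul l r w \<sigma>) p = 0}"

definition Id_UT2_D :: "('w \<Rightarrow> 'f::field^2^2) \<Rightarrow> ('i \<Rightarrow> 'w) \<Rightarrow> ('i mono \<Rightarrow>\<^sub>0 'f) set" where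
  "Id_UT2_D \<phi> w =
     graded_identities mscale (**) (\<lambda>v a. \<phi> v ** a) (\<lambda>a v. a ** \<phi> v) UT2_gr w"

definition multilinear :: "nat \<Rightarrow> ('i mono \<Rightarrow>\<^sub>0 'f::field) set" where
  "multilinear n = module.span fscale
     {Poly_Mapping.single m 1 | m. \<exists>\<pi> u. \<pi> permutes {1..n} \<and> (\<forall>i. u i \<in> {Y i, Z i}) \<and>
        letters m = map (\<lambda>i. u (\<pi> i)) [1..<Suc n]}"

text \<open>
  \<open>B\<close> is a set of representatives of a basis of the quotient \<open>U / V\<close>, for subspaces \<open>V \<subseteq> U\<close>. The
  independence condition forces distinct elements of \<open>B\<close> to lie in distinct cosets.
\<close>

definition quotient_basis ::
    "('f::field \<Rightarrow> 'a::ab_group_add \<Rightarrow> 'a) \<Rightarrow> 'a set \<Rightarrow> 'a set \<Rightarrow> 'a set \<Rightarrow> bool" where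
  "quotient_basis sW U V B \<longleftrightarrow>
     B \<subseteq> U \<and>
     (\<forall>T c. finite T \<and> T \<subseteq> B \<and> (\<Sum>b\<in>T. sW (c b) b) \<in> V \<longrightarrow> (\<forall>b\<in>T. c b = 0)) \<and>
     (\<forall>u\<in>U. \<exists>b\<in>module.span sW B. u - b \<in> V)"

text \<open>As for the library's \<open>dim\<close>, an infinite-dimensional quotient gets the value 0.\<close>

definition quotient_dim ::
    "('f::field \<Rightarrow> 'a::ab_group_add \<Rightarrow> 'a) \<Rightarrow> 'a set \<Rightarrow> 'a set \<Rightarrow> nat" where
  "quotient_dim sW U V = card (SOME B. quotient_basis sW U V B)"

definition codimension :: "('i mono \<Rightarrow>\<^sub>0 'f::field) set \<Rightarrow> nat \<Rightarrow> nat" where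
  "codimension I n = quotient_dim fscale (multilinear n) (multilinear n \<inter> I)"


section \<open>The generating polynomials\<close>

definition UT2_D_generators ::
    "('f::field \<Rightarrow> 'w::ring_1 \<Rightarrow> 'w) \<Rightarrow> ('i \<Rightarrow> 'w) \<Rightarrow> 'i \<Rightarrow> 'i \<Rightarrow> ('i mono \<Rightarrow>\<^sub>0 'f) set" where
  "UT2_D_generators sW w i0 i1 =
     (let mul = free_mult sW w; l = free_lact sW w; r = free_ract sW w;
          y = var_elt sW w (Y 1); y' = var_elt sW w (Y 2); z = var_elt sW w (Z 1)
      in {mul y y' - mul y' y, l (w i1) y - r y (w i1), r z (w i1) - z} \<union>
         {l (w i) z | i. i \<noteq> i0} \<union>
         {r z (w j) | j. j \<noteq> i0 \<and> j \<noteq> i1} \<union>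
         {l (w j) y | j. j \<noteq> i0 \<and> j \<noteq> i1} \<union>
         {r y (w j) | j. j \<noteq> i0 \<and> j \<noteq> i1})"

end

theory Submission
  imports Defs "HOL-Analysis.Cartesian_Space"
begin

text \<open>
  Modulo the seven families of generators, the basis monomials of the free algebra multiply like a
  small semigroup with zero. Its non-zero elements are \<open>Diag e A\<close>, a commutative word \<open>A\<close> in the
  variables of degree 0, preceded by \<open>w_1\<close> when \<open>e\<close> holds, and \<open>Mixed A k B\<close>, the word \<open>A z_k B\<close> with
  \<open>A\<close> and \<open>B\<close> commutative words in the variables of degree 0. All the rest vanishes: \<open>w_j\<close> with
  \<open>j \<ge> 2\<close> kills every variable, \<open>w_1\<close> can be moved past the \<open>y\<close>'s to the right until it meets a
  \<open>z\<close>, which it kills from the left, and \<open>z y \<dots> y z' = z w_1 y \<dots> y z' = z y \<dots> y w_1 z' = 0\<close>.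

  Let \<open>nf_map\<close> be the linear map that sends a monomial to its normal form in this semigroup, or to
  0. The set of identities, the T-ideal generated by the seven families and the kernel of \<open>nf_map\<close>
  coincide, by a cycle of three inclusions.

  \<^item> The generated T-ideal consists of identities: the generators vanish on the algebra, and the
  identities form a T-ideal (\<open>T_ideal_Id\<close>).

  \<^item> Identities lie in the kernel (\<open>nf_map_Id\<close>). Substituting matrices with independent entries,
  \<open>diag (a_n, b_n)\<close> for \<open>y_n\<close> and \<open>c_n e_{12}\<close> for \<open>z_n\<close>, turns a normal form into a matrix whose
  entries are monomials in these entries, and such a matrix determines the normal form. Distinct
  monomials are linearly independent as functions in characteristic zero
  (\<open>monomials_independent\<close>). No multilinearisation is needed, because this argument applies to
  all elements of the free algebra at once.

  \<^item> The kernel lies in every T-ideal \<open>I\<close> that contains the generators (\<open>nf_kernel_subset\<close>): each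
  monomial is congruent modulo \<open>I\<close> to a word that depends, up to congruence, only on its normal
  form (\<open>reduce_mono\<close>, \<open>nf_spelling_unique\<close>). The only endomorphisms that this uses are renamings of
  the variables.

  So the codimension is the number of normal forms of multilinear monomials in \<open>n\<close> variables. There
  are 2 of the form \<open>Diag e A\<close>, since \<open>A\<close> must be \<open>{1..n}\<close>, and \<open>n 2^(n-1)\<close> of the form \<open>Mixed A k B\<close>:
  choose \<open>k\<close>, and for each remaining index the side of \<open>z_k\<close> on which its variable stands.
\<close>

section \<open>Linear maps on spaces of formal linear combinations\<close>

lemma lookup_fscale [simp]: "Poly_Mapping.lookup (fscale c p) m = c * Poly_Mapping.lookup p m"
  by (simp add: fscale_def Poly_Mapping.map.rep_eq when_def)

lemma fscale_single [simp]:
  "fscale c (Poly_Mapping.single m d) = Poly_Mapping.single m (c * d)"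
  by (rule poly_mapping_eqI) (simp add: lookup_single when_def)

interpretation free_space: vector_space "fscale :: 'f::field \<Rightarrow> ('m \<Rightarrow>\<^sub>0 'f) \<Rightarrow> ('m \<Rightarrow>\<^sub>0 'f)"
  by unfold_locales (rule poly_mapping_eqI; simp add: lookup_add algebra_simps)+

abbreviation mon :: "'m \<Rightarrow> ('m \<Rightarrow>\<^sub>0 'f::field)" where
  "mon m \<equiv> Poly_Mapping.single m 1"

lemma mon_neq_0: "mon m \<noteq> 0"
  by (metis lookup_single_eq lookup_zero one_neq_zero)

lemma inj_mon: "inj mon"
  by (rule injI) (metis lookup_single_eq lookup_single_not_eq one_neq_zero)

lemma sum_mon: "p = (\<Sum>m\<in>Poly_Mapping.keys p. fscale (Poly_Mapping.lookup p m) (mon m))"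
  by (rule poly_mapping_eqI)
    (simp add: lookup_sum lookup_single when_def in_keys_iff)

lemma independent_mon: "free_space.independent (mon ` S :: ('m \<Rightarrow>\<^sub>0 'f::field) set)"
  unfolding free_space.independent_explicit_module
proof (intro allI impI)
  fix T :: "('m \<Rightarrow>\<^sub>0 'f) set" and c v
  assume T: "finite T" "T \<subseteq> mon ` S" "(\<Sum>v\<in>T. fscale (c v) v) = 0" "v \<in> T"
  then obtain R where R: "finite R" "T = mon ` R" by (meson finite_subset_image)
  have "inj_on (mon :: 'm \<Rightarrow> 'm \<Rightarrow>\<^sub>0 'f) R"
    by (rule inj_on_subset[OF inj_mon subset_UNIV])
  with T(3) have *: "(\<Sum>m\<in>R. Poly_Mapping.single m (c (mon m))) = 0"
    by (simp add: R(2) sum.reindex)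
  obtain m where m: "m \<in> R" "v = mon m" using T(4) R by auto
  have "Poly_Mapping.lookup (\<Sum>m\<in>R. Poly_Mapping.single m (c (mon m))) m = c (mon m)"
    using m R(1) by (simp add: lookup_sum lookup_single when_def)
  with * m show "c v = 0" by simp
qed

text \<open>
  The two rules below let linear statements about the free algebra be checked on monomials.
\<close>

lemma linear_subspaceI:
  assumes f: "Vector_Spaces.linear fscale s f" and S: "module.subspace s S"
    and mon: "\<And>m. f (mon m) \<in> S"
  shows "f p \<in> S"
proof -
  interpret f: Vector_Spaces.linear fscale s f by (rule f)
  have "f (\<Sum>m\<in>Poly_Mapping.keys p. fscale (Poly_Mapping.lookup p m) (mon m)) \<in> S"
    unfolding f.sum f.scale by (intro f.vs2.subspace_sum f.vs2.subspace_scale S mon)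
  then show ?thesis using sum_mon[of p] by simp
qed

lemma linear_eqI:
  assumes f: "Vector_Spaces.linear fscale s f" and g: "Vector_Spaces.linear fscale s g"
    and mon: "\<And>m. f (mon m) = g (mon m)"
  shows "f p = g p"
proof -
  interpret f: Vector_Spaces.linear fscale s f by (rule f)
  interpret g: Vector_Spaces.linear fscale s g by (rule g)
  interpret vector_space_pair fscale s ..
  have "f p - g p \<in> {0}"
    by (rule linear_subspaceI[OF linear_compose_sub[OF f g]]) (simp_all add: mon)
  then show ?thesis by simp
qed

context vector_space
begin

lemma lin_ext_superset:
  assumes "finite K" "Poly_Mapping.keys p \<subseteq> K"
  shows "lin_ext scale f p = (\<Sum>m\<in>K. scale (Poly_Mapping.lookup p m) (f m))"
  unfolding lin_ext_def by (rule sum.mono_neutral_left) (use assms in \<open>auto simp: in_keys_iff\<close>)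

lemma linear_lin_ext: "Vector_Spaces.linear fscale scale (lin_ext scale f)"
proof (rule Vector_Spaces.linear_iff[THEN iffD2], intro conjI allI)
  show "vector_space fscale" "vector_space scale" by unfold_locales
  show "lin_ext scale f (p + q) = lin_ext scale f p + lin_ext scale f q" for p q
    using keys_add[of p q]
    by (subst (1 2 3) lin_ext_superset[where K = "Poly_Mapping.keys p \<union> Poly_Mapping.keys q"])
      (auto simp: lookup_add scale_left_distrib sum.distrib)
  show "lin_ext scale f (fscale c p) = scale c (lin_ext scale f p)" for c p
    by (subst (1 2) lin_ext_superset[where K = "Poly_Mapping.keys p"])
      (auto simp: in_keys_iff scale_sum_right)
qed

lemma lin_ext_single [simp]: "lin_ext scale f (Poly_Mapping.single m c) = scale c (f m)"
  by (subst lin_ext_superset[where K = "{m}"]) auto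

end

section \<open>Two by two matrices and the canonical grading\<close>

interpretation mat_space: vector_space "mscale :: 'f::field \<Rightarrow> 'f^2^2 \<Rightarrow> 'f^2^2"
  by unfold_locales (simp_all add: vec_eq_iff mscale_def algebra_simps)

lemma mscale_nth [simp]: "mscale c A $ i $ j = c * A $ i $ j"
  by (simp add: mscale_def)

lemma E_nth [simp]: "E i j $ k $ l = (if k = i \<and> l = j then 1 else 0)"
  by (simp add: E_def)

lemma mult_nth [simp]:
  fixes A B :: "'f::field^2^2"
  shows "(A ** B) $ i $ j = A $ i $ 1 * B $ 1 $ j + A $ i $ 2 * B $ 2 $ j"
  by (simp add: matrix_matrix_mult_def sum_2)

lemma matrix2_eq_iff:
  fixes A B :: "'a^2^2"
  shows "A = B \<longleftrightarrow> A $ 1 $ 1 = B $ 1 $ 1 \<and> A $ 1 $ 2 = B $ 1 $ 2 \<and> A $ 2 $ 1 = B $ 2 $ 1 \<and> A $ 2 $ 2 = B $ 2 $ 2"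
  by (auto simp: vec_eq_iff forall_2)

lemma D_iff: "A \<in> D \<longleftrightarrow> A $ 1 $ 2 = 0 \<and> A $ 2 $ 1 = 0"
  unfolding D_def matrix2_eq_iff by auto

lemma UT2_gr_iff:
  "A \<in> UT2_gr g \<longleftrightarrow>
    A $ 2 $ 1 = 0 \<and> (if g = 0 then A $ 1 $ 2 = 0 else A $ 1 $ 1 = 0 \<and> A $ 2 $ 2 = 0)"
  by (auto simp: UT2_gr_def D_iff matrix2_eq_iff)

lemma UT2_gr_mult:
  assumes "A \<in> UT2_gr g" "B \<in> UT2_gr h"
  shows "A ** B \<in> UT2_gr (g + h)"
  using assms by (cases g; cases h) (auto simp: UT2_gr_iff)

lemma subspace_UT2_gr: "mat_space.subspace (UT2_gr g)"
  by (auto simp: mat_space.subspace_def UT2_gr_iff)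

section \<open>The dimension of a quotient by a kernel\<close>

text \<open>
  A linear map \<open>f\<close> on \<open>U\<close> induces an isomorphism from \<open>U / (U \<inter> ker f)\<close> to \<open>f ` U\<close>. Concretely, \<open>f\<close> maps
  each set of representatives injectively onto a basis of \<open>f ` U\<close>, so all such sets have the same
  cardinality, and one exists because a basis of \<open>f ` U\<close> can be lifted along \<open>f\<close>.
\<close>

lemma quotient_dim_linear_image:
  assumes f: "Vector_Spaces.linear s1 s2 f" and U: "module.subspace s1 U"
  shows "quotient_dim s1 U (U \<inter> {u. f u = 0}) = vector_space.dim s2 (f ` U)"
proof -
  interpret f: Vector_Spaces.linear s1 s2 f by (rule f)
  let ?V = "U \<inter> {u. f u = 0}"
  have comb: "(\<Sum>b\<in>T. s1 (c b) b) \<in> U" if "T \<subseteq> U" for T c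
    by (intro f.vs1.subspace_sum f.vs1.subspace_scale U) (use that in auto)
  have card: "card B = f.vs2.dim (f ` U)" if B: "quotient_basis s1 U ?V B" for B
  proof -
    have BU: "B \<subseteq> U" and indep: "\<And>T c b. finite T \<Longrightarrow> T \<subseteq> B \<Longrightarrow> (\<Sum>b\<in>T. s1 (c b) b) \<in> ?V \<Longrightarrow> b \<in> T \<Longrightarrow> c b = 0"
      and sp: "\<And>u. u \<in> U \<Longrightarrow> \<exists>b\<in>f.vs1.span B. u - b \<in> ?V"
      using B unfolding quotient_basis_def by blast+
    have inj: "inj_on f B"
    proof (rule inj_onI, rule ccontr)
      fix a b assume ab: "a \<in> B" "b \<in> B" "f a = f b" "a \<noteq> b"
      let ?c = "\<lambda>x. if x = a then 1 else - 1"
      have "(\<Sum>x\<in>{a, b}. s1 (?c x) x) = a - b"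
        using ab by simp
      moreover have "a - b \<in> ?V"
        using ab BU U by (auto simp: f.diff intro: f.vs1.subspace_diff)
      ultimately show False
        using indep[of "{a, b}" ?c a] ab by simp
    qed
    have ind: "f.vs2.independent (f ` B)"
      unfolding f.vs2.independent_explicit_module
    proof (intro allI impI)
      fix T c v assume T: "finite T" "T \<subseteq> f ` B" "(\<Sum>v\<in>T. s2 (c v) v) = 0" "v \<in> T"
      then obtain S where S: "S \<subseteq> B" "finite S" "T = f ` S"
        by (meson finite_subset_image)
      have injS: "inj_on f S" using inj S(1) inj_on_subset by blast
      have "f (\<Sum>b\<in>S. s1 (c (f b)) b) = 0"
        using T(3) by (simp add: f.sum f.scale S(3) sum.reindex[OF injS])
      moreover have "(\<Sum>b\<in>S. s1 (c (f b)) b) \<in> U"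
        by (rule comb) (use S(1) BU in simp)
      ultimately have V: "(\<Sum>b\<in>S. s1 (c (f b)) b) \<in> ?V" by simp
      obtain b where b: "b \<in> S" "v = f b" using T(4) S(3) by auto
      show "c v = 0" using indep[OF S(2,1) V b(1)] b(2) by simp
    qed
    have "f ` U \<subseteq> f.vs2.span (f ` B)"
    proof
      fix y assume "y \<in> f ` U"
      then obtain u where u: "u \<in> U" "y = f u" by auto
      then obtain b where "b \<in> f.vs1.span B" "f u = f b"
        using sp[of u] by (auto simp: f.diff)
      then show "y \<in> f.vs2.span (f ` B)"
        using u by (auto simp: f.span_image)
    qed
    then have "card (f ` B) = f.vs2.dim (f ` U)"
      using f.vs2.basis_card_eq_dim[OF image_mono[OF BU] _ ind] by simp
    then show ?thesis by (simp add: card_image[OF inj])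
  qed
  obtain C where C: "C \<subseteq> f ` U" "f.vs2.independent C" "f ` U \<subseteq> f.vs2.span C"
    using f.vs2.basis_exists[of "f ` U"] by metis
  define r where "r y = (SOME u. u \<in> U \<and> f u = y)" for y
  have r: "r y \<in> U" "f (r y) = y" if "y \<in> f ` U" for y
    unfolding r_def using someI_ex[of "\<lambda>u. u \<in> U \<and> f u = y"] that by blast+
  have rC: "r ` C \<subseteq> U" using r(1) C(1) by auto
  have frC: "f (r y) = y" if "y \<in> C" for y using r(2) C(1) that by auto
  then have fr: "f ` r ` C = C" by (simp add: image_image)
  have "quotient_basis s1 U ?V (r ` C)"
    unfolding quotient_basis_def
  proof (intro conjI allI impI ballI rC)
    fix T c b assume *: "finite T \<and> T \<subseteq> r ` C \<and> (\<Sum>b\<in>T. s1 (c b) b) \<in> ?V" and b: "b \<in> T"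
    then obtain S where S: "S \<subseteq> C" "finite S" "T = r ` S"
      by (meson finite_subset_image)
    have fr': "f (r y) = y" if "y \<in> S" for y using that S(1) frC by auto
    have "inj_on r S" by (metis fr' inj_onI)
    with * have "(\<Sum>y\<in>S. s2 (c (r y)) y) = 0"
      by (simp add: S(3) sum.reindex f.sum f.scale fr')
    then show "c b = 0"
      using f.vs2.independentD[OF C(2) S(2,1), of "\<lambda>y. c (r y)"] b S(3) by blast
  next
    fix u assume u: "u \<in> U"
    have "f u \<in> f.vs2.span (f ` r ` C)" using u C fr by auto
    then obtain b where b: "b \<in> f.vs1.span (r ` C)" "f u = f b"
      unfolding f.span_image by auto
    moreover have "b \<in> U" using b(1) f.vs1.span_minimal[OF rC U] by blast
    ultimately show "\<exists>b\<in>f.vs1.span (r ` C). u - b \<in> ?V"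
      using u U by (auto simp: f.diff intro!: bexI[of _ b] f.vs1.subspace_diff)
  qed
  then show ?thesis
    unfolding quotient_dim_def using card by (rule someI2)
qed

section \<open>Linear independence of monomial functions\<close>

definition monomial_value :: "('x \<Rightarrow> 'f::comm_monoid_mult) \<Rightarrow> 'x multiset \<Rightarrow> 'f" where
  "monomial_value v M = prod_mset (image_mset v M)"

lemma monomial_value_simps [simp]:
  "monomial_value v {#} = 1"
  "monomial_value v (add_mset x M) = v x * monomial_value v M"
  "monomial_value v (M + N) = monomial_value v M * monomial_value v N"
  by (simp_all add: monomial_value_def)

lemma monomial_value_double:
  fixes v :: "'x \<Rightarrow> 'f::field_char_0"
  shows "monomial_value (v(x := 2 * v x)) M = 2 ^ count M x * monomial_value v M"
  by (induction M) (auto simp: algebra_simps)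

text \<open>
  The argument for the independence of distinct characters. If \<open>x\<close> has different exponents in \<open>M k\<close>
  and \<open>M a\<close>, doubling the value of \<open>x\<close> multiplies the two monomials by different powers of 2, which
  are different elements of a field of characteristic zero. A suitable combination of the relation
  before and after doubling thus loses the term of \<open>a\<close> and keeps a non-zero multiple of the
  coefficient of \<open>k\<close>.
\<close>

lemma monomials_independent:
  fixes c :: "'k \<Rightarrow> 'f::field_char_0" and M :: "'k \<Rightarrow> 'x multiset"
  assumes "finite S" "inj_on M S" "\<And>v. (\<Sum>k\<in>S. c k * monomial_value v (M k)) = 0" "k \<in> S"
  shows "c k = 0"
  using assms
proof (induction S arbitrary: c k rule: finite_induct)
  case empty
  then show ?case by simp
next
  case (insert a S)
  have inj: "inj_on M S" using insert.prems(1) by simp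
  have S: "c k = 0" if k: "k \<in> S" for k
  proof -
    have "M k \<noteq> M a" using insert.prems(1) insert.hyps k by (metis inj_on_insert image_eqI insert_Diff_single Diff_insert_absorb)
    then obtain x where x: "count (M k) x \<noteq> count (M a) x" by (meson multiset_eqI)
    let ?d = "\<lambda>j. c j * (2 ^ count (M j) x - 2 ^ count (M a) x)"
    have "(\<Sum>j\<in>S. ?d j * monomial_value v (M j)) = 0" for v
    proof -
      have "(\<Sum>j\<in>insert a S. ?d j * monomial_value v (M j))
          = (\<Sum>j\<in>insert a S. c j * monomial_value (v(x := 2 * v x)) (M j))
            - 2 ^ count (M a) x * (\<Sum>j\<in>insert a S. c j * monomial_value v (M j))"
        by (simp only: monomial_value_double sum_distrib_left flip: sum_subtractf)
          (simp add: algebra_simps)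
      also have "\<dots> = 0" by (simp only: insert.prems(2)) simp
      finally show ?thesis using insert.hyps by simp
    qed
    then have "?d k = 0" using insert.IH[of ?d k] inj k by blast
    moreover have "(2::'f) ^ count (M k) x \<noteq> 2 ^ count (M a) x"
    proof
      assume "(2::'f) ^ count (M k) x = 2 ^ count (M a) x"
      then have "(of_nat (2 ^ count (M k) x) :: 'f) = of_nat (2 ^ count (M a) x)" by simp
      then show False using x by (simp only: of_nat_eq_iff) simp
    qed
    ultimately show ?thesis by simp
  qed
  have "c a * monomial_value (\<lambda>_. 1) (M a) = 0"
    using insert.prems(2)[of "\<lambda>_. 1"] insert.hyps S by simp
  then have "c a = 0" by (simp add: monomial_value_def)
  then show ?case using S insert.prems(3) by auto
qed

section \<open>Operations, bases and renamings in the free algebra\<close>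

lemma linear_compose':
  "Vector_Spaces.linear s1 s2 f \<Longrightarrow> Vector_Spaces.linear s2 s3 g \<Longrightarrow> Vector_Spaces.linear s1 s3 (\<lambda>x. g (f x))"
  using Vector_Spaces.linear_compose[of s1 s2 f s3 g] by (simp add: o_def)

lemma linear_matrix_mult_left: "Vector_Spaces.linear mscale mscale (\<lambda>A. P ** A)"
  by (auto simp: Vector_Spaces.linear_iff matrix2_eq_iff algebra_simps mat_space.vector_space_axioms)

lemma linear_matrix_mult_right: "Vector_Spaces.linear mscale mscale (\<lambda>A. A ** P)"
  by (auto simp: Vector_Spaces.linear_iff matrix2_eq_iff algebra_simps mat_space.vector_space_axioms)

lemma linear_free_lact: "Vector_Spaces.linear fscale fscale (free_lact sW w v)"
  unfolding free_lact_def by (rule free_space.linear_lin_ext)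

lemma linear_free_ract: "Vector_Spaces.linear fscale fscale (\<lambda>p. free_ract sW w p v)"
  unfolding free_ract_def by (rule free_space.linear_lin_ext)

lemma linear_free_mult_left: "Vector_Spaces.linear fscale fscale (\<lambda>p. free_mult sW w p q)"
  unfolding free_mult_def by (rule free_space.linear_lin_ext)

lemma linear_free_mult_right: "Vector_Spaces.linear fscale fscale (\<lambda>q. free_mult sW w p q)"
proof -
  interpret vector_space_pair fscale fscale ..
  show ?thesis
    unfolding free_mult_def lin_ext_def[of _ _ p]
    by (intro linear_compose_sum linear_compose_scale_right ballI free_space.linear_lin_ext)
qed

lemma free_lact_mon:
  "free_lact sW w v (mon m) = fill sW w (\<lambda>k. set_first k m) (v * w (first_idx m))"
  by (simp add: free_lact_def)

lemma free_ract_mon: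
  "free_ract sW w (mon m) v = fill sW w (\<lambda>k. set_last k m) (w (last_idx m) * v)"
  by (simp add: free_ract_def)

lemma free_mult_mon:
  "free_mult sW w (mon m) (mon m') = fill sW w (\<lambda>k. join m k m') (w (last_idx m) * w (first_idx m'))"
  by (simp add: free_mult_def)

lemma set_first_first_idx [simp]: "set_first (first_idx m) m = m"
  by (cases m) auto

lemma set_last_last_idx [simp]: "set_last (last_idx m) m = m"
  by (induction m) auto

context z2_graded_algebra
begin

text \<open>
  Write \<open>1 = u + v\<close> with \<open>u\<close> even and \<open>v\<close> odd. Comparing degrees in \<open>u = u (u + v)\<close> and \<open>v = (u + v) v\<close>
  gives \<open>u v = 0\<close> and then \<open>v = v v\<close>, which is both odd and even.
\<close>

lemma one_in_gr_0: "1 \<in> gr 0"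
proof -
  obtain u v where uv: "u \<in> gr 0" "v \<in> gr 1" "1 = u + v" using gr_sum by blast
  have uv1: "u * v \<in> gr 1" using gr_mult[OF uv(1,2)] by simp
  have "u = u * u + u * v" using uv(3) by (metis distrib_left mult.right_neutral)
  then have "u * v = u - u * u" by (metis add_diff_cancel_left')
  moreover have "u - u * u \<in> gr 0"
    using subspace_diff[OF gr_subspace uv(1)] gr_mult[OF uv(1,1)] by simp
  ultimately have "u * v \<in> gr 0 \<inter> gr 1" using uv1 by simp
  then have uv0: "u * v = 0" using gr_direct by simp
  have "v = u * v + v * v" using uv(3) by (metis distrib_right mult.left_neutral)
  then have "v = v * v" using uv0 by simp
  moreover have "v * v \<in> gr 0" using gr_mult[OF uv(2,2)] by simp
  ultimately have "v \<in> gr 0 \<inter> gr 1" using uv(2) by simp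
  then have "v = 0" using gr_direct by simp
  then show ?thesis using uv by simp
qed

end

locale based_graded_algebra = z2_graded_algebra sW gr
  for sW :: "'f::field \<Rightarrow> 'w::ring_1 \<Rightarrow> 'w" and gr +
  fixes w :: "'i \<Rightarrow> 'w" and i0 :: 'i
  assumes basis: "indexed_basis sW w"
    and w_i0: "w i0 = 1"
begin

lemma inj_w: "inj w" and independent_w: "independent (range w)" and span_w: "v \<in> span (range w)"
  using basis unfolding indexed_basis_def by auto

lemma finite_coord: "finite {k. coord sW w k v \<noteq> 0}"
  using finite_vimageI[OF finite_representation[of "range w" v] inj_w]
  by (simp add: coord_def vimage_def)

lemma coord_basis: "coord sW w k (w i) = (if k = i then 1 else 0)"
  using inj_w by (simp add: coord_def representation_basis[OF independent_w] inj_eq)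

lemma sum_coord: "(\<Sum>k | coord sW w k v \<noteq> 0. sW (coord sW w k v) (w k)) = v"
proof -
  have "{b. representation (range w) v b \<noteq> 0} = w ` {k. coord sW w k v \<noteq> 0}"
    using representation_ne_zero[of "range w" v] by (auto simp: coord_def)
  then show ?thesis
    using sum_nonzero_representation_eq[OF independent_w span_w, of v]
    by (simp add: sum.reindex[OF inj_on_subset[OF inj_w]] coord_def)
qed

lemma fill_basis: "fill sW w h (w k) = mon (h k)"
proof -
  have "{j. coord sW w j (w k) \<noteq> 0} = {k}" by (auto simp: coord_basis)
  then show ?thesis by (simp add: fill_def coord_basis)
qed

lemma wxw_basis: "wxw sW w (w i) x (w j) = mon (Unit i x j)"
proof -
  have "{k. coord sW w k (w i) \<noteq> 0} = {i}" by (auto simp: coord_basis)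
  then show ?thesis by (simp add: wxw_def coord_basis fill_basis)
qed

lemma var_elt_eq: "var_elt sW w x = mon (Unit i0 x i0)"
  unfolding var_elt_def w_i0[symmetric] by (rule wxw_basis)

text \<open>
  Because \<open>w_{i_0} = 1\<close>, every basis monomial is obtained from variables by the product and the two
  actions. A graded endomorphism, or an evaluation, is therefore determined by its values on the
  variables.
\<close>

lemma mon_Unit: "mon (Unit i x j) = free_ract sW w (free_lact sW w (w i) (var_elt sW w x)) (w j)"
  by (simp add: var_elt_eq free_lact_mon free_ract_mon w_i0 fill_basis)

lemma mon_Step: "mon (Step i x m) = free_mult sW w (free_lact sW w (w i) (var_elt sW w x)) (mon m)"
  by (simp add: var_elt_eq free_lact_mon free_mult_mon w_i0 fill_basis)

lemma var_elt_in_free_gr: "var_elt sW w x \<in> free_gr sW gr w (var_deg x)"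
proof -
  have "hom_mono sW gr w (0 + var_deg x + 0) (wxw sW w 1 x 1)"
    by (rule hom_mono.unit) (rule one_in_gr_0)+
  then show ?thesis
    unfolding free_gr_def var_elt_def add_0_left add_0_right by (auto intro: free_space.span_base)
qed

lemma graded_endo_var_elt:
  assumes "graded_endo sW gr w f"
  shows "f (var_elt sW w x) \<in> free_gr sW gr w (var_deg x)"
  using assms var_elt_in_free_gr unfolding graded_endo_def by blast

end

primrec rename :: "(var \<Rightarrow> var) \<Rightarrow> 'i mono \<Rightarrow> 'i mono" where
  "rename \<rho> (Unit i x j) = Unit i (\<rho> x) j"
| "rename \<rho> (Step i x m) = Step i (\<rho> x) (rename \<rho> m)"

lemma rename_simps [simp]:
  "first_idx (rename \<rho> m) = first_idx m"
  "last_idx (rename \<rho> m) = last_idx m"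
  "rename \<rho> (set_first k m) = set_first k (rename \<rho> m)"
  by (induction m) auto

lemma rename_set_last [simp]: "rename \<rho> (set_last k m) = set_last k (rename \<rho> m)"
  by (induction m) auto

lemma rename_join [simp]: "rename \<rho> (join m k m') = join (rename \<rho> m) k (rename \<rho> m')"
  by (induction m) auto

definition rename_free :: "(var \<Rightarrow> var) \<Rightarrow> ('i mono \<Rightarrow>\<^sub>0 'f::field) \<Rightarrow> ('i mono \<Rightarrow>\<^sub>0 'f)" where
  "rename_free \<rho> = lin_ext fscale (\<lambda>m. mon (rename \<rho> m))"

lemma linear_rename_free: "Vector_Spaces.linear fscale fscale (rename_free \<rho>)"
  unfolding rename_free_def by (rule free_space.linear_lin_ext)

lemma rename_free_single [simp]:
  "rename_free \<rho> (Poly_Mapping.single m c) = Poly_Mapping.single (rename \<rho> m) c"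
  by (simp add: rename_free_def)

lemma rename_free_fill: "rename_free \<rho> (fill sW w h v) = fill sW w (\<lambda>k. rename \<rho> (h k)) v"
proof -
  interpret r: Vector_Spaces.linear fscale fscale "rename_free \<rho>" by (rule linear_rename_free)
  show ?thesis by (simp add: fill_def r.sum)
qed

lemma rename_free_wxw: "rename_free \<rho> (wxw sW w v x v') = wxw sW w v (\<rho> x) v'"
proof -
  interpret r: Vector_Spaces.linear fscale fscale "rename_free \<rho>" by (rule linear_rename_free)
  show ?thesis by (simp add: wxw_def r.sum r.scale rename_free_fill)
qed

lemma rename_free_mult:
  "rename_free \<rho> (free_mult sW w p q) = free_mult sW w (rename_free \<rho> p) (rename_free \<rho> q)"
proof -
  have mon: "rename_free \<rho> (free_mult sW w (mon m) q) = free_mult sW w (mon (rename \<rho> m)) (rename_free \<rho> q)" for m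
    by (rule linear_eqI[where p = q])
      (auto intro!: linear_compose'[OF linear_free_mult_right linear_rename_free]
        linear_compose'[OF linear_rename_free linear_free_mult_right]
        simp: free_mult_mon rename_free_fill)
  show ?thesis
    by (rule linear_eqI[where p = p])
      (auto intro!: linear_compose'[OF linear_free_mult_left linear_rename_free]
        linear_compose'[OF linear_rename_free linear_free_mult_left] mon)
qed

lemma rename_free_lact: "rename_free \<rho> (free_lact sW w v p) = free_lact sW w v (rename_free \<rho> p)"
  by (rule linear_eqI[where p = p])
    (auto intro!: linear_compose'[OF linear_free_lact linear_rename_free]
      linear_compose'[OF linear_rename_free linear_free_lact]
      simp: free_lact_mon rename_free_fill)

lemma rename_free_ract: "rename_free \<rho> (free_ract sW w p v) = free_ract sW w (rename_free \<rho> p) v"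
  by (rule linear_eqI[where p = p])
    (auto intro!: linear_compose'[OF linear_free_ract linear_rename_free]
      linear_compose'[OF linear_rename_free linear_free_ract]
      simp: free_ract_mon rename_free_fill)

text \<open>
  Renamings transport each generator, which is written in \<open>Y 1\<close>, \<open>Y 2\<close> and \<open>Z 1\<close> only, to all
  variables of the same degree.
\<close>

lemma graded_endo_rename_free:
  assumes deg: "\<And>x. var_deg (\<rho> x) = var_deg x"
  shows "graded_endo sW gr w (rename_free \<rho>)"
  unfolding graded_endo_def
proof (intro conjI allI ballI rename_free_mult rename_free_lact rename_free_ract)
  interpret r: Vector_Spaces.linear fscale fscale "rename_free \<rho>" by (rule linear_rename_free)
  show "rename_free \<rho> (p + q) = rename_free \<rho> p + rename_free \<rho> q" for p q by (rule r.add)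
  show "rename_free \<rho> (fscale c p) = fscale c (rename_free \<rho> p)" for c p by (rule r.scale)
  have hom: "hom_mono sW gr w g (rename_free \<rho> p)" if "hom_mono sW gr w g p" for g p
    using that
  proof induction
    case (unit v g v' h x)
    then show ?case
      using hom_mono.unit[of v gr g v' h sW w "\<rho> x"] by (simp add: rename_free_wxw deg)
  next
    case (step v g h p x)
    then show ?case
      using hom_mono.step[of v gr g sW w h "rename_free \<rho> p" "\<rho> x"]
      by (simp add: rename_free_mult rename_free_wxw deg)
  qed
  show "rename_free \<rho> p \<in> free_gr sW gr w g" if "p \<in> free_gr sW gr w g" for g p
  proof -
    have "rename_free \<rho> p \<in> free_space.span (rename_free \<rho> ` {p. hom_mono sW gr w g p})"
      using that unfolding free_gr_def r.span_image by (rule imageI)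
    also have "\<dots> \<subseteq> free_space.span {p. hom_mono sW gr w g p}"
      by (rule free_space.span_mono) (auto intro: hom)
    finally show ?thesis by (simp add: free_gr_def)
  qed
qed

section \<open>The semigroup of normal forms\<close>

text \<open>
  The independent entries of the generic matrices that are substituted for the variables.
\<close>

datatype entry = E11 nat | E22 nat | E12 nat

text \<open>
  \<open>Diag e A\<close> is the commutative word \<open>A\<close> in the variables \<open>Y\<close>, with a factor \<open>w_1\<close> when \<open>e\<close> holds;
  \<open>Mixed A k B\<close> is \<open>A z_k B\<close>; \<open>Null\<close> is the zero of the semigroup. The multisets in \<open>Diag\<close> may be
  empty: \<open>Diag False {#}\<close> is the unit and \<open>Diag True {#}\<close> is \<open>w_1\<close> itself.
\<close>

datatype nf = Null | Diag bool "nat multiset" | Mixed "nat multiset" nat "nat multiset"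

fun nf_mult :: "nf \<Rightarrow> nf \<Rightarrow> nf" where
  "nf_mult (Diag e A) (Diag f B) = Diag (e \<or> f) (A + B)"
| "nf_mult (Diag e A) (Mixed B k C) = (if e then Null else Mixed (A + B) k C)"
| "nf_mult (Mixed A k B) (Diag e C) = Mixed A k (B + C)"
| "nf_mult _ _ = Null"

fun nf_var :: "var \<Rightarrow> nf" where
  "nf_var (Y n) = Diag False {#n#}"
| "nf_var (Z n) = Mixed {#} n {#}"

primrec nf_value :: "(entry \<Rightarrow> 'f::field) \<Rightarrow> nf \<Rightarrow> 'f^2^2" where
  "nf_value v Null = 0"
| "nf_value v (Diag e A) =
    mscale (if e then 0 else monomial_value (\<lambda>n. v (E11 n)) A) (E 1 1)
    + mscale (monomial_value (\<lambda>n. v (E22 n)) A) (E 2 2)"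
| "nf_value v (Mixed A k B) =
    mscale (monomial_value (\<lambda>n. v (E11 n)) A * v (E12 k) * monomial_value (\<lambda>n. v (E22 n)) B) (E 1 2)"

lemma nf_value_mult: "nf_value v (nf_mult a b) = nf_value v a ** nf_value v b"
  by (cases "(a, b)" rule: nf_mult.cases) (auto simp: matrix2_eq_iff)

fun generic_subst :: "(entry \<Rightarrow> 'f::field) \<Rightarrow> var \<Rightarrow> 'f^2^2" where
  "generic_subst v (Y n) = mscale (v (E11 n)) (E 1 1) + mscale (v (E22 n)) (E 2 2)"
| "generic_subst v (Z n) = mscale (v (E12 n)) (E 1 2)"

lemma generic_subst_graded: "generic_subst v x \<in> UT2_gr (var_deg x)"
  by (cases x) (auto simp: UT2_gr_iff)

lemma nf_value_var: "nf_value v (nf_var x) = generic_subst v x"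
  by (cases x) (auto simp: matrix2_eq_iff)

text \<open>
  The monomial in the entries that identifies a normal form: it stands in position (1,2) for
  \<open>Mixed\<close>, in (1,1) for \<open>Diag False\<close> and in (2,2) for \<open>Diag True\<close>. For \<open>Diag False\<close> the position (2,2) is
  occupied as well, by the monomial of \<open>Diag True\<close> with the same multiset.
\<close>

primrec nf_monomial :: "nf \<Rightarrow> entry multiset" where
  "nf_monomial Null = {#}"
| "nf_monomial (Diag e A) = image_mset (if e then E22 else E11) A"
| "nf_monomial (Mixed A k B) = image_mset E11 A + {#E12 k#} + image_mset E22 B"

lemma monomial_value_image: "monomial_value v (image_mset f A) = monomial_value (\<lambda>n. v (f n)) A"
  by (induction A) auto

text \<open>
  Reading off one matrix entry yields a linear relation between monomials, provided that the normal
  forms outside \<open>S\<close> contribute nothing to this entry.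
\<close>

lemma nf_entry_independent:
  fixes q :: "nf \<Rightarrow>\<^sub>0 'f::field_char_0"
  assumes zero: "\<And>v. lin_ext mscale (nf_value v) q = 0"
    and inj: "inj_on nf_monomial S"
    and val: "\<And>(v :: entry \<Rightarrow> 'f) a. a \<in> S \<Longrightarrow> nf_value v a $ i $ j = monomial_value v (nf_monomial a)"
    and oth: "\<And>(v :: entry \<Rightarrow> 'f) a. a \<in> Poly_Mapping.keys q \<Longrightarrow> a \<notin> S \<Longrightarrow> nf_value v a $ i $ j = 0"
    and a: "a \<in> S"
  shows "Poly_Mapping.lookup q a = 0"
proof (cases "a \<in> Poly_Mapping.keys q")
  case True
  let ?S = "Poly_Mapping.keys q \<inter> S" and ?c = "Poly_Mapping.lookup q"
  have "(\<Sum>a\<in>?S. ?c a * monomial_value v (nf_monomial a)) = 0" for v :: "entry \<Rightarrow> 'f"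
  proof -
    have "(\<Sum>a\<in>?S. ?c a * monomial_value v (nf_monomial a)) = (\<Sum>a\<in>?S. ?c a * nf_value v a $ i $ j)"
      using val by (intro sum.cong) auto
    also have "\<dots> = (\<Sum>a\<in>Poly_Mapping.keys q. ?c a * nf_value v a $ i $ j)"
      by (rule sum.mono_neutral_left) (auto simp: oth)
    also have "\<dots> = lin_ext mscale (nf_value v) q $ i $ j"
      by (simp add: lin_ext_def)
    finally show ?thesis by (simp add: zero)
  qed
  then show ?thesis
    using True a inj by (intro monomials_independent[of ?S nf_monomial ?c a]) (auto intro: inj_on_subset)
qed (simp add: in_keys_iff)

text \<open>
  The three multisets can be recovered since \<open>A\<close>, \<open>k\<close> and \<open>B\<close> are recorded in entries of different kinds.
\<close>

lemma inj_nf_monomial_Mixed: "inj_on nf_monomial {Mixed A k B | A k B. True}"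
proof -
  have cnt: "count (image_mset E11 A) (E11 n) = count A n" "count (image_mset E22 A) (E22 n) = count A n"
    "count (image_mset E11 A) (E22 n) = 0" "count (image_mset E22 A) (E11 n) = 0"
    "count (image_mset E11 A) (E12 n) = 0" "count (image_mset E22 A) (E12 n) = 0" for A n
    by (induction A) auto
  have "A = A' \<and> k = k' \<and> B = B'"
    if eq: "nf_monomial (Mixed A k B) = nf_monomial (Mixed A' k' B')" for A k B A' k' B'
  proof -
    have c: "count (nf_monomial (Mixed A k B)) x = count (nf_monomial (Mixed A' k' B')) x" for x
      unfolding eq ..
    have "count A n = count A' n" for n using c[of "E11 n"] by (simp add: cnt)
    moreover have "count B n = count B' n" for n using c[of "E22 n"] by (simp add: cnt)
    moreover have "k = k'" using c[of "E12 k"] by (simp add: cnt split: if_splits)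
    ultimately show ?thesis by (simp add: multiset_eq_iff)
  qed
  then show ?thesis unfolding inj_on_def by blast
qed

text \<open>
  The order of the entries matters: position (2,2) separates the forms \<open>Diag True\<close> only after position
  (1,1), where \<open>w_1\<close> acts as zero, has shown that the coefficients of the forms \<open>Diag False\<close> vanish.
\<close>

lemma nf_values_independent:
  fixes q :: "nf \<Rightarrow>\<^sub>0 'f::field_char_0"
  assumes zero: "\<And>v. lin_ext mscale (nf_value v) q = 0"
    and Null: "Poly_Mapping.lookup q Null = 0"
  shows "q = 0"
proof -
  have inj: "inj_on nf_monomial (range (Diag e))" for e
  proof (rule inj_onI, clarify)
    fix A B assume "nf_monomial (Diag e A) = nf_monomial (Diag e B)"
    moreover have "inj (if e then E22 else E11)" by (simp add: inj_def)
    ultimately show "e = e \<and> A = B"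
      using multiset.inj_map by (metis injD nf_monomial.simps(2))
  qed
  have F: "Poly_Mapping.lookup q (Diag False A) = 0" for A
  proof (rule nf_entry_independent[OF zero inj, of _ 1 1])
    fix v :: "entry \<Rightarrow> 'f" and a assume "a \<notin> range (Diag False)"
    then show "nf_value v a $ 1 $ 1 = 0" by (cases a) auto
  qed (auto simp: monomial_value_image)
  have T: "Poly_Mapping.lookup q (Diag True A) = 0" for A
  proof (rule nf_entry_independent[OF zero inj, of _ 2 2])
    fix v :: "entry \<Rightarrow> 'f" and a assume "a \<in> Poly_Mapping.keys q" "a \<notin> range (Diag True)"
    then show "nf_value v a $ 2 $ 2 = 0"
      using F by (cases a; cases "\<exists>A. a = Diag False A") (auto simp: in_keys_iff)
  qed (auto simp: monomial_value_image)
  have M: "Poly_Mapping.lookup q (Mixed A k B) = 0" for A k B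
  proof (rule nf_entry_independent[OF zero inj_nf_monomial_Mixed, of 1 2])
    fix v :: "entry \<Rightarrow> 'f" and a assume "a \<notin> {Mixed A k B | A k B. True}"
    then show "nf_value v a $ 1 $ 2 = 0" by (cases a) auto
  qed (auto simp: monomial_value_image)
  show ?thesis
  proof (rule poly_mapping_eqI)
    show "Poly_Mapping.lookup q a = Poly_Mapping.lookup 0 a" for a
    proof (cases a)
      case (Diag e A)
      then show ?thesis by (cases e) (simp_all add: F T)
    qed (simp_all add: Null M)
  qed
qed

section \<open>Evaluation of the free algebra in the matrices\<close>

locale UT2_D_action = based_graded_algebra sW gr w i0
  for sW :: "'f::field_char_0 \<Rightarrow> 'w::ring_1 \<Rightarrow> 'w" and gr and w :: "'i \<Rightarrow> 'w" and i0 +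
  fixes \<phi> :: "'w \<Rightarrow> 'f^2^2" and i1 :: 'i
  assumes hom: "unital_graded_hom_UT2 sW gr \<phi>"
    and phi_i1: "\<phi> (w i1) = E 2 2"
    and phi_other: "j \<noteq> i0 \<Longrightarrow> j \<noteq> i1 \<Longrightarrow> \<phi> (w j) = 0"
begin

lemma linear_phi: "Vector_Spaces.linear sW mscale \<phi>"
  using hom by (auto simp: unital_graded_hom_UT2_def Vector_Spaces.linear_iff
      vector_space_axioms mat_space.vector_space_axioms)

lemma phi_mult: "\<phi> (x * y) = \<phi> x ** \<phi> y" and phi_one: "\<phi> 1 = mat 1"
  and phi_gr: "x \<in> gr g \<Longrightarrow> \<phi> x \<in> UT2_gr g"
  using hom by (auto simp: unital_graded_hom_UT2_def)

lemma phi_i0: "\<phi> (w i0) = mat 1"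
  by (simp add: w_i0 phi_one)

lemma i1_neq_i0: "i1 \<noteq> i0"
proof
  assume "i1 = i0"
  then have "mat 1 = (E 2 2 :: 'f^2^2)" using phi_i0 phi_i1 by simp
  then show False by (simp add: matrix2_eq_iff mat_def)
qed

lemma phi_basis: "\<phi> (w k) = (if k = i0 then mat 1 else if k = i1 then E 2 2 else 0)"
  using phi_i0 phi_i1 phi_other by simp

lemma phi_expand: "\<phi> v = (\<Sum>k | coord sW w k v \<noteq> 0. mscale (coord sW w k v) (\<phi> (w k)))"
proof -
  interpret p: Vector_Spaces.linear sW mscale \<phi> by (rule linear_phi)
  show ?thesis by (subst sum_coord[of v, symmetric]) (simp only: p.sum p.scale)
qed

abbreviation value_mono :: "(var \<Rightarrow> 'f^2^2) \<Rightarrow> 'i mono \<Rightarrow> 'f^2^2" where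
  "value_mono \<sigma> \<equiv> eval_mono (**) (\<lambda>v a. \<phi> v ** a) (\<lambda>a v. a ** \<phi> v) w \<sigma>"

definition value_at :: "(var \<Rightarrow> 'f^2^2) \<Rightarrow> ('i mono \<Rightarrow>\<^sub>0 'f) \<Rightarrow> 'f^2^2" where
  "value_at \<sigma> = lin_ext mscale (value_mono \<sigma>)"

lemma Id_iff: "p \<in> Id_UT2_D \<phi> w \<longleftrightarrow> (\<forall>\<sigma>. (\<forall>x. \<sigma> x \<in> UT2_gr (var_deg x)) \<longrightarrow> value_at \<sigma> p = 0)"
  by (simp add: Id_UT2_D_def graded_identities_def value_at_def)

lemma linear_value_at: "Vector_Spaces.linear fscale mscale (value_at \<sigma>)"
  unfolding value_at_def by (rule mat_space.linear_lin_ext)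

lemma value_at_mon [simp]: "value_at \<sigma> (mon m) = value_mono \<sigma> m"
  by (simp add: value_at_def)

text \<open>
  A monomial depends linearly on the element of \<open>W\<close> in one of its places. The next lemmas exhibit
  this dependence as \<open>P ** \<phi> (w k) ** Q\<close> for the first place, the last place and the place where two
  monomials are joined; multiplicativity of \<open>\<phi>\<close> then shows that evaluation respects all operations.
\<close>

lemma value_at_fill:
  assumes "\<And>k. value_mono \<sigma> (h k) = P ** \<phi> (w k) ** Q"
  shows "value_at \<sigma> (fill sW w h v) = P ** \<phi> v ** Q"
proof -
  interpret e: Vector_Spaces.linear fscale mscale "value_at \<sigma>" by (rule linear_value_at)
  interpret l: Vector_Spaces.linear mscale mscale "\<lambda>A. P ** A ** Q"
    by (rule linear_compose'[OF linear_matrix_mult_left linear_matrix_mult_right])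
  have "value_at \<sigma> (Poly_Mapping.single m c) = mscale c (value_mono \<sigma> m)" for m c
    by (simp add: value_at_def)
  then show ?thesis
    by (subst phi_expand) (simp only: fill_def e.sum l.sum l.scale assms)
qed

lemma value_mono_set_first: obtains Q where "\<And>k. value_mono \<sigma> (set_first k m) = \<phi> (w k) ** Q"
  by (cases m) (auto simp: matrix_mul_assoc[symmetric])

lemma value_mono_set_last: obtains P where "\<And>k. value_mono \<sigma> (set_last k m) = P ** \<phi> (w k)"
proof -
  have "\<exists>P. \<forall>k. value_mono \<sigma> (set_last k m) = P ** \<phi> (w k)"
  proof (induction m)
    case (Step i x m)
    then show ?case by (auto simp: matrix_mul_assoc)
  qed auto
  then show ?thesis using that by blast
qed

lemma value_mono_join:
  assumes "\<And>k. value_mono \<sigma> (set_last k m) = P ** \<phi> (w k)"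
    and "\<And>k. value_mono \<sigma> (set_first k m') = \<phi> (w k) ** Q"
  shows "value_mono \<sigma> (join m k m') = P ** \<phi> (w k) ** Q"
proof -
  have "\<exists>P. (\<forall>k. value_mono \<sigma> (set_last k m) = P ** \<phi> (w k)) \<and>
    (\<forall>k. value_mono \<sigma> (join m k m') = P ** \<phi> (w k) ** Q)"
  proof (induction m)
    case (Unit i x j)
    show ?case by (rule exI[of _ "\<phi> (w i) ** \<sigma> x"]) (simp add: assms(2) matrix_mul_assoc)
  next
    case (Step i x m)
    then obtain P where "\<And>k. value_mono \<sigma> (set_last k m) = P ** \<phi> (w k)"
      "\<And>k. value_mono \<sigma> (join m k m') = P ** \<phi> (w k) ** Q" by blast
    then show ?case by (intro exI[of _ "\<phi> (w i) ** \<sigma> x ** P"]) (simp add: matrix_mul_assoc)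
  qed
  then obtain P' where P': "\<And>k. value_mono \<sigma> (set_last k m) = P' ** \<phi> (w k)"
      "\<And>k. value_mono \<sigma> (join m k m') = P' ** \<phi> (w k) ** Q" by blast
  \<comment> \<open>The prefix matrix is unique: its value at \<open>k = i0\<close> is the matrix itself, as \<open>w_{i_0} = 1\<close>.\<close>
  then have "P' ** \<phi> (w i0) = P ** \<phi> (w i0)" using assms(1) by metis
  then show ?thesis using P'(2) by (simp add: phi_i0)
qed

lemma value_at_lact: "value_at \<sigma> (free_lact sW w v p) = \<phi> v ** value_at \<sigma> p"
proof (rule linear_eqI[where p = p])
  show "value_at \<sigma> (free_lact sW w v (mon m)) = \<phi> v ** value_at \<sigma> (mon m)" for m
  proof -
    obtain Q where Q: "\<And>k. value_mono \<sigma> (set_first k m) = \<phi> (w k) ** Q"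
      using value_mono_set_first by blast
    have "value_mono \<sigma> m = \<phi> (w (first_idx m)) ** Q" using Q[of "first_idx m"] by simp
    then show ?thesis
      using value_at_fill[of \<sigma> "\<lambda>k. set_first k m" "mat 1" Q] Q
      by (simp add: free_lact_mon phi_mult matrix_mul_assoc)
  qed
qed (rule linear_compose'[OF linear_free_lact linear_value_at]
      linear_compose'[OF linear_value_at linear_matrix_mult_left])+

lemma value_at_ract: "value_at \<sigma> (free_ract sW w p v) = value_at \<sigma> p ** \<phi> v"
proof (rule linear_eqI[where p = p])
  show "value_at \<sigma> (free_ract sW w (mon m) v) = value_at \<sigma> (mon m) ** \<phi> v" for m
  proof -
    obtain P where P: "\<And>k. value_mono \<sigma> (set_last k m) = P ** \<phi> (w k)"
      using value_mono_set_last by blast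
    have "value_mono \<sigma> m = P ** \<phi> (w (last_idx m))" using P[of "last_idx m"] by simp
    then show ?thesis
      using value_at_fill[of \<sigma> "\<lambda>k. set_last k m" P "mat 1"] P
      by (simp add: free_ract_mon phi_mult matrix_mul_assoc)
  qed
qed (rule linear_compose'[OF linear_free_ract linear_value_at]
      linear_compose'[OF linear_value_at linear_matrix_mult_right])+

lemma value_at_mult: "value_at \<sigma> (free_mult sW w p q) = value_at \<sigma> p ** value_at \<sigma> q"
proof (rule linear_eqI[where p = p])
  show "value_at \<sigma> (free_mult sW w (mon m) q) = value_at \<sigma> (mon m) ** value_at \<sigma> q" for m
  proof (rule linear_eqI[where p = q])
    show "value_at \<sigma> (free_mult sW w (mon m) (mon m')) = value_at \<sigma> (mon m) ** value_at \<sigma> (mon m')" for m'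
    proof -
      obtain P where P: "\<And>k. value_mono \<sigma> (set_last k m) = P ** \<phi> (w k)"
        using value_mono_set_last by blast
      obtain Q where Q: "\<And>k. value_mono \<sigma> (set_first k m') = \<phi> (w k) ** Q"
        using value_mono_set_first by blast
      have "value_mono \<sigma> m = P ** \<phi> (w (last_idx m))" using P[of "last_idx m"] by simp
      moreover have "value_mono \<sigma> m' = \<phi> (w (first_idx m')) ** Q" using Q[of "first_idx m'"] by simp
      ultimately show ?thesis
        using value_at_fill[of \<sigma> "\<lambda>k. join m k m'" P Q] value_mono_join[OF P Q]
        by (simp add: free_mult_mon phi_mult matrix_mul_assoc)
    qed
  qed (rule linear_compose'[OF linear_free_mult_right linear_value_at]
        linear_compose'[OF linear_value_at linear_matrix_mult_left])+
qed (rule linear_compose'[OF linear_free_mult_left linear_value_at]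
      linear_compose'[OF linear_value_at linear_matrix_mult_right])+

lemma value_at_wxw: "value_at \<sigma> (wxw sW w v x v') = \<phi> v ** \<sigma> x ** \<phi> v'"
proof -
  interpret e: Vector_Spaces.linear fscale mscale "value_at \<sigma>" by (rule linear_value_at)
  interpret l: Vector_Spaces.linear mscale mscale "\<lambda>A. A ** \<sigma> x ** \<phi> v'"
    by (rule linear_compose'[OF linear_matrix_mult_right linear_matrix_mult_right])
  have "value_at \<sigma> (fill sW w (Unit i x) v') = \<phi> (w i) ** \<sigma> x ** \<phi> v'" for i
    using value_at_fill[of \<sigma> "Unit i x" "\<phi> (w i) ** \<sigma> x" "mat 1"] by simp
  then show ?thesis
    by (subst phi_expand[of v]) (simp add: wxw_def e.sum e.scale l.sum l.scale)
qed

lemma value_at_graded: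
  assumes \<sigma>: "\<And>x. \<sigma> x \<in> UT2_gr (var_deg x)" and p: "p \<in> free_gr sW gr w g"
  shows "value_at \<sigma> p \<in> UT2_gr g"
proof -
  interpret e: Vector_Spaces.linear fscale mscale "value_at \<sigma>" by (rule linear_value_at)
  have hom: "value_at \<sigma> p \<in> UT2_gr g" if "hom_mono sW gr w g p" for p g
    using that
  proof induction
    case (unit v g v' h x)
    then show ?case unfolding value_at_wxw by (intro UT2_gr_mult phi_gr \<sigma>)
  next
    case (step v g h p x)
    then show ?case
      unfolding value_at_mult value_at_wxw phi_one matrix_mul_rid
      by (intro UT2_gr_mult phi_gr \<sigma>)
  qed
  have "value_at \<sigma> p \<in> mat_space.span (value_at \<sigma> ` {p. hom_mono sW gr w g p})"
    using p unfolding free_gr_def e.span_image by (rule imageI)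
  also have "\<dots> \<subseteq> UT2_gr g"
    by (rule mat_space.span_minimal[OF _ subspace_UT2_gr]) (auto intro: hom)
  finally show ?thesis .
qed

text \<open>
  Evaluating after an endomorphism is evaluating at a substitution that is again graded. This is why
  the identities are closed under endomorphisms.
\<close>

lemma value_at_endo:
  assumes f: "graded_endo sW gr w f"
  shows "value_at \<sigma> (f p) = value_at (\<lambda>x. value_at \<sigma> (f (var_elt sW w x))) p"
proof (rule linear_eqI[where p = p])
  have lin: "Vector_Spaces.linear fscale fscale f"
    using f by (auto simp: graded_endo_def Vector_Spaces.linear_iff free_space.vector_space_axioms)
  show "Vector_Spaces.linear fscale mscale (\<lambda>p. value_at \<sigma> (f p))"
    by (rule linear_compose'[OF lin linear_value_at])
  show "Vector_Spaces.linear fscale mscale (value_at (\<lambda>x. value_at \<sigma> (f (var_elt sW w x))))"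
    by (rule linear_value_at)
  have f_eqs: "f (free_mult sW w p q) = free_mult sW w (f p) (f q)"
    "f (free_lact sW w v p) = free_lact sW w v (f p)"
    "f (free_ract sW w p v) = free_ract sW w (f p) v" for p q v
    using f unfolding graded_endo_def by blast+
  show "value_at \<sigma> (f (mon m)) = value_at (\<lambda>x. value_at \<sigma> (f (var_elt sW w x))) (mon m)" for m
  proof (induction m)
    case (Unit i x j)
    show ?case
      by (subst mon_Unit) (simp only: f_eqs value_at_ract value_at_lact value_at_mon eval_mono.simps)
  next
    case (Step i x m)
    show ?case
      by (subst mon_Step) (simp only: f_eqs value_at_mult value_at_lact value_at_mon eval_mono.simps
          Step.IH)
  qed
qed

lemma T_ideal_Id: "T_ideal sW gr w (Id_UT2_D \<phi> w)"
  unfolding T_ideal_def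
proof (intro conjI ballI allI impI)
  have "Id_UT2_D \<phi> w = (\<Inter>\<sigma>\<in>{\<sigma>. \<forall>x. \<sigma> x \<in> UT2_gr (var_deg x)}. {p. value_at \<sigma> p = 0})"
    by (auto simp: Id_iff)
  also have "free_space.subspace \<dots>"
  proof (intro free_space.subspace_Inter ballI, elim imageE)
    fix A \<sigma> assume A: "A = {p. value_at \<sigma> p = 0}"
    interpret e: Vector_Spaces.linear fscale mscale "value_at \<sigma>" by (rule linear_value_at)
    show "free_space.subspace A" unfolding A by (rule e.subspace_kernel)
  qed
  finally show "free_space.subspace (Id_UT2_D \<phi> w)" .
next
  fix p q v assume "p \<in> Id_UT2_D \<phi> w"
  then show "free_mult sW w p q \<in> Id_UT2_D \<phi> w" "free_mult sW w q p \<in> Id_UT2_D \<phi> w"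
    "free_lact sW w v p \<in> Id_UT2_D \<phi> w" "free_ract sW w p v \<in> Id_UT2_D \<phi> w"
    by (auto simp: Id_iff value_at_mult value_at_lact value_at_ract)
next
  fix f assume f: "graded_endo sW gr w f"
  show "f ` Id_UT2_D \<phi> w \<subseteq> Id_UT2_D \<phi> w"
  proof clarify
    fix p assume p: "p \<in> Id_UT2_D \<phi> w"
    show "f p \<in> Id_UT2_D \<phi> w"
      unfolding Id_iff
    proof (intro allI impI)
      fix \<sigma> :: "var \<Rightarrow> 'f^2^2" assume "\<forall>x. \<sigma> x \<in> UT2_gr (var_deg x)"
      then have "value_at \<sigma> (f (var_elt sW w x)) \<in> UT2_gr (var_deg x)" for x
        using value_at_graded[OF _ graded_endo_var_elt[OF f]] by blast
      then show "value_at \<sigma> (f p) = 0"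
        using p by (subst value_at_endo[OF f]) (simp add: Id_iff)
    qed
  qed
qed

lemma generators_in_Id: "UT2_D_generators sW w i0 i1 \<subseteq> Id_UT2_D \<phi> w"
proof
  fix p assume p: "p \<in> UT2_D_generators sW w i0 i1"
  have "value_at \<sigma> p = 0" if \<sigma>: "\<And>x. \<sigma> x \<in> UT2_gr (var_deg x)" for \<sigma> :: "var \<Rightarrow> 'f^2^2"
  proof -
    interpret e: Vector_Spaces.linear fscale mscale "value_at \<sigma>" by (rule linear_value_at)
    have y: "\<sigma> (Y n) $ 1 $ 2 = 0" "\<sigma> (Y n) $ 2 $ 1 = 0" for n
      using \<sigma>[of "Y n"] by (auto simp: UT2_gr_iff)
    have z: "\<sigma> (Z n) $ 1 $ 1 = 0" "\<sigma> (Z n) $ 2 $ 1 = 0" "\<sigma> (Z n) $ 2 $ 2 = 0" for n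
      using \<sigma>[of "Z n"] by (auto simp: UT2_gr_iff)
    have var: "value_at \<sigma> (var_elt sW w x) = \<sigma> x" for x
      by (simp add: var_elt_def value_at_wxw phi_one)
    show ?thesis
      using p unfolding UT2_D_generators_def Let_def
      by (auto simp: e.diff value_at_mult value_at_lact value_at_ract var phi_basis i1_neq_i0
          matrix2_eq_iff y z split: if_splits)
  qed
  then show "p \<in> Id_UT2_D \<phi> w" by (simp add: Id_iff)
qed

section \<open>The normal form of a monomial\<close>

definition nf_idx :: "'i \<Rightarrow> nf" where
  "nf_idx i = (if i = i0 then Diag False {#} else if i = i1 then Diag True {#} else Null)"

primrec nf_of :: "'i mono \<Rightarrow> nf" where
  "nf_of (Unit i x j) = nf_mult (nf_mult (nf_idx i) (nf_var x)) (nf_idx j)"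
| "nf_of (Step i x m) = nf_mult (nf_mult (nf_idx i) (nf_var x)) (nf_of m)"

lemma nf_value_idx: "nf_value v (nf_idx i) = \<phi> (w i)"
  by (auto simp: nf_idx_def phi_basis i1_neq_i0 matrix2_eq_iff mat_def)

lemma value_mono_nf: "value_mono (generic_subst v) m = nf_value v (nf_of m)"
  by (induction m) (simp_all add: nf_value_mult nf_value_idx nf_value_var)

definition nf_map :: "('i mono \<Rightarrow>\<^sub>0 'f) \<Rightarrow> (nf \<Rightarrow>\<^sub>0 'f)" where
  "nf_map = lin_ext fscale (\<lambda>m. if nf_of m = Null then 0 else mon (nf_of m))"

lemma linear_nf_map: "Vector_Spaces.linear fscale fscale nf_map"
  unfolding nf_map_def by (rule free_space.linear_lin_ext)

lemma nf_map_mon: "nf_map (mon m) = (if nf_of m = Null then 0 else mon (nf_of m))"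
  by (simp add: nf_map_def)

text \<open>
  Evaluation at generic matrices factors through \<open>nf_map\<close>, so an identity is mapped to a combination of
  normal forms whose values vanish at all generic matrices.
\<close>

lemma value_at_nf_map: "value_at (generic_subst v) p = lin_ext mscale (nf_value v) (nf_map p)"
proof (rule linear_eqI[where p = p])
  show "Vector_Spaces.linear fscale mscale (\<lambda>p. lin_ext mscale (nf_value v) (nf_map p))"
    by (rule linear_compose'[OF linear_nf_map mat_space.linear_lin_ext])
  show "value_at (generic_subst v) (mon m) = lin_ext mscale (nf_value v) (nf_map (mon m))" for m
    by (auto simp: nf_map_mon value_mono_nf lin_ext_def)
qed (rule linear_value_at)

lemma lookup_nf_map_Null: "Poly_Mapping.lookup (nf_map p) Null = 0"
proof -
  have "nf_map p \<in> {q. Poly_Mapping.lookup q Null = 0}"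
    by (rule linear_subspaceI[OF linear_nf_map])
      (auto simp: free_space.subspace_def lookup_add nf_map_mon lookup_single when_def)
  then show ?thesis by simp
qed

lemma nf_map_Id:
  assumes "p \<in> Id_UT2_D \<phi> w"
  shows "nf_map p = 0"
proof (rule nf_values_independent[OF _ lookup_nf_map_Null])
  show "lin_ext mscale (nf_value v) (nf_map p) = 0" for v
  proof -
    have "value_at (generic_subst v) p = 0"
      using assms generic_subst_graded unfolding Id_iff by blast
    then show ?thesis by (simp only: value_at_nf_map)
  qed
qed

end

section \<open>Reduction of monomials modulo a T-ideal\<close>

context UT2_D_action
begin

text \<open>
  The words to which monomials are reduced: \<open>e\<close> is the index in front and all other indices are \<open>i0\<close>.
  There is no monomial without letters, so the value at the empty list is unspecified.
\<close>

fun word :: "'i \<Rightarrow> var list \<Rightarrow> 'i mono" where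
  "word e [x] = Unit e x i0"
| "word e (x # y # xs) = Step e x (word i0 (y # xs))"

lemma word_Cons: "xs \<noteq> [] \<Longrightarrow> word e (x # xs) = Step e x (word i0 xs)"
  by (cases xs) auto

lemma word_simps [simp]:
  assumes "xs \<noteq> []"
  shows "first_idx (word e xs) = e" "set_first e' (word e xs) = word e' xs"
  using assms by (cases "(e, xs)" rule: word.cases; simp)+

lemma fill_one: "fill sW w h 1 = mon (h i0)"
  using fill_basis[of h i0] by (simp add: w_i0)

lemma free_mult_mon_last_i0:
  "last_idx m = i0 \<Longrightarrow> free_mult sW w (mon m) (mon n) = mon (join m (first_idx n) n)"
  by (simp add: free_mult_mon w_i0 fill_basis)

lemma free_mult_mon_first_i0:
  "first_idx n = i0 \<Longrightarrow> free_mult sW w (mon m) (mon n) = mon (join m (last_idx m) n)"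
  by (simp add: free_mult_mon w_i0 fill_basis)

text \<open>
  The coordinates at \<open>i0\<close> and \<open>i1\<close> of an element of \<open>W\<close> are visible in its image
  \<open>\<phi> v = v_{i_0} 1 + v_{i_1} e_{22}\<close>.
\<close>

lemma coord_i0: "coord sW w i0 v = \<phi> v $ 1 $ 1"
proof -
  have "\<phi> v $ 1 $ 1 = (\<Sum>k | coord sW w k v \<noteq> 0. if k = i0 then coord sW w k v else 0)"
    by (subst phi_expand) (auto intro!: sum.cong simp: phi_basis mat_def)
  also have "\<dots> = coord sW w i0 v"
    using finite_coord[of v] by (auto simp: sum.delta')
  finally show ?thesis ..
qed

lemma coord_i1: "coord sW w i1 v = \<phi> v $ 2 $ 2 - \<phi> v $ 1 $ 1"
proof -
  have "\<phi> v $ 2 $ 2 = (\<Sum>k | coord sW w k v \<noteq> 0. (if k = i0 then coord sW w k v else 0) + (if k = i1 then coord sW w k v else 0))"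
    by (subst phi_expand) (auto intro!: sum.cong simp: phi_basis mat_def i1_neq_i0)
  also have "\<dots> = coord sW w i0 v + coord sW w i1 v"
    using finite_coord[of v] by (auto simp: sum.delta' sum.distrib)
  finally show ?thesis by (simp add: coord_i0)
qed

end

locale UT2_D_T_ideal = UT2_D_action sW gr w i0 \<phi> i1
  for sW :: "'f::field_char_0 \<Rightarrow> 'w::ring_1 \<Rightarrow> 'w" and gr and w :: "'i \<Rightarrow> 'w" and i0
    and \<phi> :: "'w \<Rightarrow> 'f^2^2" and i1 +
  fixes I :: "('i mono \<Rightarrow>\<^sub>0 'f) set"
  assumes T_ideal: "T_ideal sW gr w I"
    and generators: "UT2_D_generators sW w i0 i1 \<subseteq> I"
begin

lemma subspace_I: "free_space.subspace I"
  and mult_left_I: "p \<in> I \<Longrightarrow> free_mult sW w q p \<in> I"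
  and mult_right_I: "p \<in> I \<Longrightarrow> free_mult sW w p q \<in> I"
  and lact_I: "p \<in> I \<Longrightarrow> free_lact sW w v p \<in> I"
  and ract_I: "p \<in> I \<Longrightarrow> free_ract sW w p v \<in> I"
  using T_ideal unfolding T_ideal_def by blast+

lemma rename_I:
  assumes "p \<in> I" "\<And>x. var_deg (\<rho> x) = var_deg x"
  shows "rename_free \<rho> p \<in> I"
  using T_ideal graded_endo_rename_free[OF assms(2)] assms(1) unfolding T_ideal_def by blast

definition equiv_mod_I :: "'i mono \<Rightarrow> 'i mono \<Rightarrow> bool"  (infix "\<simeq>" 50) where
  "m \<simeq> n \<longleftrightarrow> mon m - mon n \<in> I"

lemma equiv_refl [simp]: "m \<simeq> m"
  using free_space.subspace_0[OF subspace_I] by (simp add: equiv_mod_I_def)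

lemma equiv_sym: "m \<simeq> n \<Longrightarrow> n \<simeq> m"
  using free_space.subspace_neg[OF subspace_I] unfolding equiv_mod_I_def by fastforce

lemma equiv_trans [trans]: "m \<simeq> n \<Longrightarrow> n \<simeq> k \<Longrightarrow> m \<simeq> k"
  using free_space.subspace_add[OF subspace_I, of "mon m - mon n" "mon n - mon k"]
  by (simp add: equiv_mod_I_def)

lemma equiv_null: "m \<simeq> n \<Longrightarrow> mon n \<in> I \<Longrightarrow> mon m \<in> I"
  using free_space.subspace_add[OF subspace_I, of "mon m - mon n" "mon n"]
  by (simp add: equiv_mod_I_def)

lemma equiv_mult:
  assumes "m \<simeq> n"
  shows "free_mult sW w q (mon m) - free_mult sW w q (mon n) \<in> I"
    and "free_mult sW w (mon m) q - free_mult sW w (mon n) q \<in> I"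
    and "free_lact sW w v (mon m) - free_lact sW w v (mon n) \<in> I"
proof -
  interpret r: Vector_Spaces.linear fscale fscale "free_mult sW w q" by (rule linear_free_mult_right)
  interpret l: Vector_Spaces.linear fscale fscale "\<lambda>p. free_mult sW w p q" by (rule linear_free_mult_left)
  interpret a: Vector_Spaces.linear fscale fscale "free_lact sW w v" by (rule linear_free_lact)
  show "free_mult sW w q (mon m) - free_mult sW w q (mon n) \<in> I"
    "free_mult sW w (mon m) q - free_mult sW w (mon n) q \<in> I"
    "free_lact sW w v (mon m) - free_lact sW w v (mon n) \<in> I"
    using assms mult_left_I mult_right_I lact_I
    by (auto simp: equiv_mod_I_def simp flip: r.diff l.diff a.diff)
qed

lemma equiv_Step: "m \<simeq> n \<Longrightarrow> Step i x m \<simeq> Step i x n"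
  unfolding equiv_mod_I_def[of "Step i x m"] mon_Step[of _ _ m] mon_Step[of _ _ n] by (rule equiv_mult)

lemma null_Step: "mon m \<in> I \<Longrightarrow> mon (Step i x m) \<in> I"
  unfolding mon_Step by (rule mult_left_I)

lemma null_first:
  assumes "mon (Unit i x i0) \<in> I"
  shows "mon (Unit i x j) \<in> I" and "mon (Step i x m) \<in> I"
proof -
  show "mon (Unit i x j) \<in> I"
    using ract_I[OF assms, of "w j"] by (simp add: free_ract_mon w_i0 fill_basis)
  show "mon (Step i x m) \<in> I"
    using mult_right_I[OF assms, of "mon m"] by (simp add: free_mult_mon_last_i0)
qed

lemma null_last: "mon (Unit i0 x j) \<in> I \<Longrightarrow> mon (Unit i x j) \<in> I"
  using lact_I[of "mon (Unit i0 x j)" "w i"] by (simp add: free_lact_mon w_i0 fill_basis)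

text \<open>
  In terms of basis monomials, and after renaming, the generators are the following congruences.
\<close>

lemma generator_monomials:
  shows y_y: "Step i0 (Y a) (Unit i0 (Y b) i0) \<simeq> Step i0 (Y b) (Unit i0 (Y a) i0)"
    and i1_y: "Unit i1 (Y a) i0 \<simeq> Unit i0 (Y a) i1"
    and z_i1: "Unit i0 (Z k) i1 \<simeq> Unit i0 (Z k) i0"
    and i_z: "i \<noteq> i0 \<Longrightarrow> mon (Unit i (Z k) i0) \<in> I"
    and z_j: "j \<noteq> i0 \<Longrightarrow> j \<noteq> i1 \<Longrightarrow> mon (Unit i0 (Z k) j) \<in> I"
    and j_y: "j \<noteq> i0 \<Longrightarrow> j \<noteq> i1 \<Longrightarrow> mon (Unit j (Y a) i0) \<in> I"
    and y_j: "j \<noteq> i0 \<Longrightarrow> j \<noteq> i1 \<Longrightarrow> mon (Unit i0 (Y a) j) \<in> I"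
proof -
  \<comment> \<open>The renaming from the variables of the generators to the given ones.\<close>
  define \<rho> where "\<rho> x = (case x of Y n \<Rightarrow> Y (if n = 1 then a else b) | Z n \<Rightarrow> Z k)" for x
  interpret r: Vector_Spaces.linear fscale fscale "rename_free \<rho>" by (rule linear_rename_free)
  have deg: "var_deg (\<rho> x) = var_deg x" for x by (cases x) (auto simp: \<rho>_def)
  have \<rho>: "\<rho> (Y 1) = Y a" "\<rho> (Y 2) = Y b" "\<rho> (Z 1) = Z k" by (auto simp: \<rho>_def)
  have ren: "rename_free \<rho> p \<in> I" if "p \<in> UT2_D_generators sW w i0 i1" for p
    using that generators rename_I[OF _ deg] by blast
  have lv: "free_lact sW w (w i) (var_elt sW w x) = mon (Unit i x i0)" for i x
    by (simp add: var_elt_eq free_lact_mon w_i0 fill_basis)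
  have rv: "free_ract sW w (var_elt sW w x) (w j) = mon (Unit i0 x j)" for j x
    by (simp add: var_elt_eq free_ract_mon w_i0 fill_basis)
  have vv: "free_mult sW w (var_elt sW w x) (var_elt sW w y) = mon (Step i0 x (Unit i0 y i0))" for x y
    by (simp add: var_elt_eq free_mult_mon w_i0 fill_one)
  have gens: "UT2_D_generators sW w i0 i1 =
    {mon (Step i0 (Y 1) (Unit i0 (Y 2) i0)) - mon (Step i0 (Y 2) (Unit i0 (Y 1) i0)),
     mon (Unit i1 (Y 1) i0) - mon (Unit i0 (Y 1) i1), mon (Unit i0 (Z 1) i1) - mon (Unit i0 (Z 1) i0)} \<union>
    {mon (Unit i (Z 1) i0) | i. i \<noteq> i0} \<union> {mon (Unit i0 (Z 1) j) | j. j \<noteq> i0 \<and> j \<noteq> i1} \<union>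
    {mon (Unit j (Y 1) i0) | j. j \<noteq> i0 \<and> j \<noteq> i1} \<union> {mon (Unit i0 (Y 1) j) | j. j \<noteq> i0 \<and> j \<noteq> i1}"
    unfolding UT2_D_generators_def Let_def
    unfolding lv rv vv
    unfolding var_elt_eq by (rule refl)
  show "Step i0 (Y a) (Unit i0 (Y b) i0) \<simeq> Step i0 (Y b) (Unit i0 (Y a) i0)"
    using ren[of "mon (Step i0 (Y 1) (Unit i0 (Y 2) i0)) - mon (Step i0 (Y 2) (Unit i0 (Y 1) i0))"]
    unfolding r.diff rename_free_single rename.simps \<rho> equiv_mod_I_def gens by blast
  show "Unit i1 (Y a) i0 \<simeq> Unit i0 (Y a) i1"
    using ren[of "mon (Unit i1 (Y 1) i0) - mon (Unit i0 (Y 1) i1)"]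
    unfolding r.diff rename_free_single rename.simps \<rho> equiv_mod_I_def gens by blast
  show "Unit i0 (Z k) i1 \<simeq> Unit i0 (Z k) i0"
    using ren[of "mon (Unit i0 (Z 1) i1) - mon (Unit i0 (Z 1) i0)"]
    unfolding r.diff rename_free_single rename.simps \<rho> equiv_mod_I_def gens by blast
  show "mon (Unit i (Z k) i0) \<in> I" if "i \<noteq> i0"
    using ren[of "mon (Unit i (Z 1) i0)"] that
    unfolding rename_free_single rename.simps \<rho> gens by blast
  assume j: "j \<noteq> i0" "j \<noteq> i1"
  show "mon (Unit i0 (Z k) j) \<in> I"
    using ren[of "mon (Unit i0 (Z 1) j)"] j
    unfolding rename_free_single rename.simps \<rho> gens by blast
  show "mon (Unit j (Y a) i0) \<in> I"
    using ren[of "mon (Unit j (Y 1) i0)"] j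
    unfolding rename_free_single rename.simps \<rho> gens by blast
  show "mon (Unit i0 (Y a) j) \<in> I"
    using ren[of "mon (Unit i0 (Y 1) j)"] j
    unfolding rename_free_single rename.simps \<rho> gens by blast
qed

lemma null_bad_left: "j \<noteq> i0 \<Longrightarrow> j \<noteq> i1 \<Longrightarrow> mon (Unit j x i0) \<in> I"
  by (cases x) (auto intro: i_z j_y)

lemma null_bad_right: "j \<noteq> i0 \<Longrightarrow> j \<noteq> i1 \<Longrightarrow> mon (Unit i0 x j) \<in> I"
  by (cases x) (auto intro: z_j y_j)

text \<open>
  An element of \<open>W\<close> that acts like \<open>w_1\<close> differs from \<open>w_1\<close> by a combination of the \<open>w_j\<close> that act as
  zero. This will be applied to \<open>w_1 w_1\<close>, which need not equal \<open>w_1\<close> in \<open>W\<close>.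
\<close>

lemma fill_like_i1:
  assumes v: "\<phi> v = E 2 2" and null: "\<And>j. j \<noteq> i0 \<Longrightarrow> j \<noteq> i1 \<Longrightarrow> mon (h j) \<in> I"
  shows "fill sW w h v - mon (h i1) \<in> I"
proof -
  let ?K = "{k. coord sW w k v \<noteq> 0}"
  have c: "coord sW w i0 v = 0" "coord sW w i1 v = 1" by (simp_all add: coord_i0 coord_i1 v)
  have "fill sW w h v = mon (h i1) + (\<Sum>k\<in>?K - {i1}. fscale (coord sW w k v) (mon (h k)))"
    unfolding fill_def by (subst sum.remove[OF finite_coord, of i1]) (simp_all add: c)
  then have "fill sW w h v - mon (h i1) = (\<Sum>k\<in>?K - {i1}. fscale (coord sW w k v) (mon (h k)))"
    by simp
  also have "\<dots> \<in> I"
    using c(1) by (intro free_space.subspace_sum free_space.subspace_scale subspace_I null) auto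
  finally show ?thesis .
qed

text \<open>
  \<open>w_1 y w_1\<close> is congruent to \<open>w_1 w_1 y\<close>, hence to \<open>w_1 y\<close>.
\<close>

lemma i1_y_i1: "Unit i1 (Y a) i1 \<simeq> Unit i1 (Y a) i0"
proof -
  have "fill sW w (\<lambda>k. Unit k (Y a) i0) (w i1 * w i1) - mon (Unit i1 (Y a) i1) \<in> I"
    using equiv_mult(3)[OF i1_y[of a], where v = "w i1"] by (simp add: free_lact_mon w_i0 fill_basis)
  moreover have "fill sW w (\<lambda>k. Unit k (Y a) i0) (w i1 * w i1) - mon (Unit i1 (Y a) i0) \<in> I"
    by (rule fill_like_i1) (simp_all add: phi_mult phi_i1 matrix2_eq_iff null_bad_left)
  ultimately show ?thesis
    using free_space.subspace_diff[OF subspace_I] unfolding equiv_mod_I_def by fastforce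
qed

lemma y_i1: "i \<in> {i0, i1} \<Longrightarrow> Unit i (Y a) i1 \<simeq> Unit i1 (Y a) i0"
  using i1_y_i1 equiv_sym[OF i1_y] by auto

text \<open>
  Inside a monomial, \<open>w_1\<close> is pulled to the front past a \<open>y\<close> and absorbed by a \<open>z\<close> on its left.
\<close>

lemma y_i1_Step:
  assumes "i \<in> {i0, i1}" "first_idx m = i0"
  shows "Step i (Y a) (set_first i1 m) \<simeq> Step i1 (Y a) m"
proof -
  have "set_first i0 m = m" using assms(2) set_first_first_idx by metis
  then show ?thesis
    using equiv_mult(2)[OF y_i1[OF assms(1), of a], where q = "mon m"] assms(2)
    by (simp add: free_mult_mon_first_i0 equiv_mod_I_def)
qed

lemma z_i1_Step:
  assumes "first_idx m = i0"
  shows "Step i0 (Z k) (set_first i1 m) \<simeq> Step i0 (Z k) m"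
proof -
  have "set_first i0 m = m" using assms set_first_first_idx by metis
  then show ?thesis
    using equiv_mult(2)[OF z_i1[of k], where q = "mon m"] assms
    by (simp add: free_mult_mon_first_i0 equiv_mod_I_def)
qed

lemma y_y_Step:
  assumes "e \<in> {i0, i1}"
  shows "Step e (Y a) (Step i0 (Y b) m) \<simeq> Step e (Y b) (Step i0 (Y a) m)"
proof -
  have "Step i0 (Y a) (Step i0 (Y b) m) \<simeq> Step i0 (Y b) (Step i0 (Y a) m)"
    using equiv_mult(2)[OF y_y[of a b], where q = "mon m"] by (simp add: free_mult_mon_last_i0 equiv_mod_I_def)
  from equiv_mult(3)[OF this, where v = "w e"] show ?thesis
    by (simp add: free_lact_mon w_i0 fill_basis equiv_mod_I_def)
qed

lemma y_y_Unit:
  assumes "e \<in> {i0, i1}"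
  shows "Step e (Y a) (Unit i0 (Y b) i0) \<simeq> Step e (Y b) (Unit i0 (Y a) i0)"
  using equiv_mult(3)[OF y_y[of a b], where v = "w e"]
  by (simp add: free_lact_mon w_i0 fill_basis equiv_mod_I_def)

lemma word_swap:
  assumes "e \<in> {i0, i1}"
  shows "word e (Y a # Y b # xs) \<simeq> word e (Y b # Y a # xs)"
  using y_y_Step[OF assms] y_y_Unit[OF assms] by (cases xs) auto

lemma word_Cons_cong: "xs \<noteq> [] \<Longrightarrow> ys \<noteq> [] \<Longrightarrow> word i0 xs \<simeq> word i0 ys \<Longrightarrow> word e (x # xs) \<simeq> word e (x # ys)"
  by (simp add: word_Cons equiv_Step)

text \<open>
  Adjacent \<open>y\<close>'s commute, so a letter can be moved to the front, and words in \<open>y\<close>'s with the same letters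
  are congruent.
\<close>

lemma word_bring_front:
  assumes "e \<in> {i0, i1}"
  shows "word e (map Y p @ Y a # xs) \<simeq> word e (Y a # map Y p @ xs)"
  using assms
proof (induction p arbitrary: e)
  case (Cons b p)
  have "word e (Y b # (map Y p @ Y a # xs)) \<simeq> word e (Y b # (Y a # map Y p @ xs))"
    using Cons.IH[of i0] by (intro word_Cons_cong) (simp_all del: word.simps)
  also have "\<dots> \<simeq> word e (Y a # Y b # map Y p @ xs)" by (rule word_swap) (rule Cons.prems)
  finally show ?case by (simp del: word.simps)
qed simp

lemma word_permute:
  assumes "e \<in> {i0, i1}" "mset xs = mset ys"
  shows "word e (map Y xs @ zs) \<simeq> word e (map Y ys @ zs)"
  using assms
proof (induction xs arbitrary: e ys)
  case (Cons a xs)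
  have "a \<in> set ys" using Cons.prems(2) by (metis list.set_intros(1) set_mset_mset)
  then obtain p q where ys: "ys = p @ a # q" by (meson split_list)
  then have "mset xs = mset (p @ q)" using Cons.prems(2) by simp
  then have IH: "word i0 (map Y xs @ zs) \<simeq> word i0 (map Y (p @ q) @ zs)"
    by (intro Cons.IH) auto
  have "xs = [] \<longleftrightarrow> p @ q = []" using \<open>mset xs = mset (p @ q)\<close> by (metis mset_zero_iff)
  then have "word e (Y a # (map Y xs @ zs)) \<simeq> word e (Y a # (map Y (p @ q) @ zs))"
    using IH by (cases "map Y xs @ zs = []") (auto intro!: word_Cons_cong simp del: word.simps)
  also have "\<dots> \<simeq> word e (map Y p @ Y a # map Y q @ zs)"
    using equiv_sym[OF word_bring_front[OF Cons.prems(1), of p a "map Y q @ zs"]]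
    by (simp del: word.simps)
  finally show ?case by (simp add: ys del: word.simps)
qed simp

lemma word_Cons_permute:
  assumes "mset xs = mset ys"
  shows "word i0 (us @ Z k # map Y xs) \<simeq> word i0 (us @ Z k # map Y ys)"
proof -
  have "word e (Z k # map Y xs) \<simeq> word e (Z k # map Y ys)" for e
  proof (cases "xs = []")
    case True
    then show ?thesis using assms by simp
  next
    case False
    then have "ys \<noteq> []" using assms by auto
    then show ?thesis
      using False word_permute[OF _ assms, of i0 "[]"] by (intro word_Cons_cong) auto
  qed
  then have "word e (us @ Z k # map Y xs) \<simeq> word e (us @ Z k # map Y ys)" for e
    by (induction us arbitrary: e) (auto intro!: word_Cons_cong simp del: word.simps)
  then show ?thesis .
qed

text \<open>
  Here \<open>w_1\<close> travels to the right, through the \<open>y\<close>'s, until it stands to the left of \<open>z_k\<close>.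
\<close>

lemma null_word_i1_z: "mon (word i1 (map Y xs @ Z k # zs)) \<in> I"
proof (induction xs)
  case Nil
  show ?case
    using null_first[OF i_z[OF i1_neq_i0, of k]] i_z[OF i1_neq_i0, of k] by (cases zs) auto
next
  case (Cons a xs)
  let ?m = "word i0 (map Y xs @ Z k # zs)"
  have "word i1 (map Y (a # xs) @ Z k # zs) = Step i1 (Y a) ?m" by (simp add: word_Cons)
  also have "\<dots> \<simeq> Step i0 (Y a) (set_first i1 ?m)"
    by (rule equiv_sym[OF y_i1_Step]) auto
  finally show ?case by (rule equiv_null) (use null_Step[OF Cons.IH] in simp)
qed

text \<open>
  A normal form has several spellings, one for each order of its commuting letters. \<open>Null\<close> and the
  forms without letters have none.
\<close>

fun nf_spelling :: "nf \<Rightarrow> 'i mono \<Rightarrow> bool" where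
  "nf_spelling Null n \<longleftrightarrow> False"
| "nf_spelling (Diag e A) n \<longleftrightarrow>
    (\<exists>xs. xs \<noteq> [] \<and> mset xs = A \<and> n = word (if e then i1 else i0) (map Y xs))"
| "nf_spelling (Mixed A k B) n \<longleftrightarrow>
    (\<exists>xs ys. mset xs = A \<and> mset ys = B \<and> n = word i0 (map Y xs @ Z k # map Y ys))"

lemma nf_spelling_unique:
  assumes "nf_spelling a m" "nf_spelling a n"
  shows "m \<simeq> n"
proof (cases a)
  case (Diag e A)
  then show ?thesis
    using assms word_permute[of "if e then i1 else i0" _ _ "[]"] by auto
next
  case (Mixed A k B)
  obtain xs ys where m: "mset xs = A" "mset ys = B" "m = word i0 (map Y xs @ Z k # map Y ys)"
    using assms(1) unfolding Mixed nf_spelling.simps by blast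
  obtain xs' ys' where n: "mset xs' = A" "mset ys' = B" "n = word i0 (map Y xs' @ Z k # map Y ys')"
    using assms(2) unfolding Mixed nf_spelling.simps by blast
  have "m \<simeq> word i0 (map Y xs' @ Z k # map Y ys)"
    unfolding m(3) by (rule word_permute) (simp_all add: m n)
  also have "\<dots> \<simeq> n"
    unfolding n(3) by (rule word_Cons_permute) (simp add: m n)
  finally show ?thesis .
qed (use assms in auto)

lemma nf_idx_cases:
  obtains "i \<noteq> i0" "i \<noteq> i1" "nf_idx i = Null"
  | e where "i = (if e then i1 else i0)" "nf_idx i = Diag e {#}"
proof -
  consider "i = i0" | "i = i1" | "i \<noteq> i0" "i \<noteq> i1" by blast
  then show thesis
  proof cases
    case 1
    then show ?thesis using that(2)[of False] by (simp add: nf_idx_def)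
  next
    case 2
    then show ?thesis using that(2)[of True] i1_neq_i0 by (simp add: nf_idx_def)
  next
    case 3
    then show ?thesis using that(1) by (simp add: nf_idx_def)
  qed
qed

lemma nf_mult_Null [simp]: "nf_mult Null a = Null" "nf_mult a Null = Null"
  by (cases a; simp)+

text \<open>
  The induction reads the monomial from its right end and follows the multiplication table of normal
  forms. Apart from those with an index that acts as zero, the vanishing products are \<open>w_1 (A z B)\<close> and \<open>z (A z' B)\<close>; in the second one a \<open>w_1\<close> is first
  created to the right of \<open>z\<close>, which reduces it to the first.
\<close>

lemma reduce_mono:
  "(nf_of m = Null \<longrightarrow> mon m \<in> I) \<and> (nf_of m \<noteq> Null \<longrightarrow> (\<exists>n. nf_spelling (nf_of m) n \<and> m \<simeq> n))"
proof (induction m)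
  case (Unit i x j)
  show ?case
  proof (cases i rule: nf_idx_cases)
    case 1
    then show ?thesis using null_first(1)[OF null_bad_left] by simp
  next
    case i: (2 e)
    show ?thesis
    proof (cases j rule: nf_idx_cases)
      case 1
      then show ?thesis using null_last[OF null_bad_right] by simp
    next
      case j: (2 f)
      show ?thesis
      proof (cases x)
        case (Y a)
        have "Unit i (Y a) j \<simeq> word (if e \<or> f then i1 else i0) (map Y [a])"
          using i(1) j(1) y_i1[of i a] by auto
        then show ?thesis using Y i(2) j(2) by (force intro!: exI[of _ "[a]"])
      next
        case (Z k)
        show ?thesis
        proof (cases e)
          case True
          then show ?thesis
            using Z i j null_first(1)[OF i_z[OF i1_neq_i0]] by simp
        next
          case False
          have "Unit i (Z k) j \<simeq> word i0 (map Y [] @ Z k # map Y [])"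
            using False i(1) j(1) z_i1[of k] by auto
          then show ?thesis using Z i(2) j(2) False by (force intro!: exI[of _ "[]"])
        qed
      qed
    qed
  qed
next
  case (Step i x m)
  show ?case
  proof (cases i rule: nf_idx_cases)
    case 1
    then show ?thesis using null_first(2)[OF null_bad_left] by simp
  next
    case i: (2 e)
    have i01: "i \<in> {i0, i1}" using i(1) by auto
    show ?thesis
    proof (cases "nf_of m")
      case Null
      then show ?thesis using Step.IH null_Step by auto
    next
      case (Diag f A)
      then obtain xs where xs: "xs \<noteq> []" "mset xs = A" "m \<simeq> word (if f then i1 else i0) (map Y xs)"
        using Step.IH by auto
      then have m: "Step i x m \<simeq> Step i x (set_first (if f then i1 else i0) (word i0 (map Y xs)))"
        by (auto intro: equiv_Step)
      show ?thesis
      proof (cases x)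
        case (Y a)
        have "Step i x m \<simeq> word (if e \<or> f then i1 else i0) (map Y (a # xs))"
          using m i(1) xs(1) y_i1_Step[OF i01, of "word i0 (map Y xs)" a]
          by (auto simp: Y word_Cons intro: equiv_trans)
        then show ?thesis using Y i(2) Diag xs by (force intro!: exI[of _ "a # xs"])
      next
        case (Z k)
        show ?thesis
        proof (cases e)
          case True
          then show ?thesis
            using Z i Diag null_first(2)[OF i_z[OF i1_neq_i0]] by simp
        next
          case False
          have "Step i x m \<simeq> word i0 (map Y [] @ Z k # map Y xs)"
            using m False i(1) xs(1) z_i1_Step[of "word i0 (map Y xs)" k]
            by (auto simp: Z word_Cons intro: equiv_trans)
          then show ?thesis using Z i(2) Diag False xs(2) by (auto simp del: map_append intro!: exI)
        qed
      qed
    next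
      case (Mixed A l B)
      then obtain xs ys where xs: "mset xs = A" "mset ys = B" "m \<simeq> word i0 (map Y xs @ Z l # map Y ys)"
        using Step.IH by auto
      let ?n = "word i0 (map Y xs @ Z l # map Y ys)"
      have m: "Step i x m \<simeq> Step i x ?n" using xs(3) by (rule equiv_Step)
      have null: "mon (Step i' x' (set_first i1 ?n)) \<in> I" for i' x'
        by (rule null_Step) (simp add: null_word_i1_z)
      show ?thesis
      proof (cases x)
        case (Y a)
        show ?thesis
        proof (cases e)
          case True
          have "Step i1 (Y a) ?n \<simeq> Step i0 (Y a) (set_first i1 ?n)"
            by (rule equiv_sym[OF y_i1_Step]) auto
          then have "mon (Step i1 (Y a) ?n) \<in> I" using null by (rule equiv_null)
          then have "mon (Step i x m) \<in> I"
            using equiv_null[OF m] True i(1) Y by simp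
          then show ?thesis using Y i(2) True Mixed by simp
        next
          case False
          have "Step i x m \<simeq> word i0 (map Y (a # xs) @ Z l # map Y ys)"
            using m False i(1) by (simp add: Y word_Cons)
          moreover have "nf_spelling (Mixed (add_mset a A) l B) (word i0 (map Y (a # xs) @ Z l # map Y ys))"
            unfolding nf_spelling.simps by (intro exI[of _ "a # xs"] exI[of _ ys]) (simp add: xs(1,2))
          moreover have "nf_of (Step i x m) = Mixed (add_mset a A) l B"
            using Y i(2) Mixed False by simp
          ultimately show ?thesis by auto
        qed
      next
        case (Z k)
        have "mon (Step i x m) \<in> I"
        proof (cases e)
          case True
          then show ?thesis using Z i null_first(2)[OF i_z[OF i1_neq_i0]] by simp
        next
          case False
          have "Step i0 (Z k) ?n \<simeq> Step i0 (Z k) (set_first i1 ?n)"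
            by (rule equiv_sym[OF z_i1_Step]) auto
          then have "mon (Step i0 (Z k) ?n) \<in> I" using null by (rule equiv_null)
          then show ?thesis
            using equiv_null[OF m] False i(1) Z by simp
        qed
        then show ?thesis using Z i(2) Mixed by (cases e) auto
      qed
    qed
  qed
qed

end

context UT2_D_T_ideal
begin

text \<open>
  Choosing a spelling of each normal form gives a linear map \<open>s\<close> such that \<open>p - s (nf_map p)\<close> lies in \<open>I\<close>
  for all \<open>p\<close>.
\<close>

lemma nf_kernel_subset:
  assumes "nf_map p = 0"
  shows "p \<in> I"
proof -
  define s :: "(nf \<Rightarrow>\<^sub>0 'f) \<Rightarrow> ('i mono \<Rightarrow>\<^sub>0 'f)"
    where "s = lin_ext fscale (\<lambda>a. mon (SOME n. nf_spelling a n))"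
  interpret s: Vector_Spaces.linear fscale fscale s
    unfolding s_def by (rule free_space.linear_lin_ext)
  interpret vector_space_pair fscale fscale ..
  have s_mon: "s (mon a) = mon (SOME n. nf_spelling a n)" for a by (simp add: s_def)
  have "p - s (nf_map p) \<in> I"
  proof (rule linear_subspaceI[where f = "\<lambda>p. p - s (nf_map p)", OF _ subspace_I])
    show "Vector_Spaces.linear fscale fscale (\<lambda>p. p - s (nf_map p))"
      by (intro linear_compose_sub free_space.linear_ident linear_compose'[OF linear_nf_map s.linear_axioms])
    show "mon m - s (nf_map (mon m)) \<in> I" for m
    proof (cases "nf_of m = Null")
      case True
      then show ?thesis using reduce_mono[of m] by (simp add: nf_map_mon)
    next
      case False
      then obtain n where n: "nf_spelling (nf_of m) n" "m \<simeq> n" using reduce_mono by blast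
      have "n \<simeq> (SOME n. nf_spelling (nf_of m) n)"
        by (rule nf_spelling_unique[OF n(1) someI[of "nf_spelling (nf_of m)", OF n(1)]])
      with n(2) have "m \<simeq> (SOME n. nf_spelling (nf_of m) n)" by (rule equiv_trans)
      then show ?thesis using False by (simp add: nf_map_mon s_mon equiv_mod_I_def)
    qed
  qed
  then show ?thesis using assms by simp
qed

end

section \<open>Counting multilinear normal forms\<close>

fun var_index :: "var \<Rightarrow> nat" where
  "var_index (Y n) = n"
| "var_index (Z n) = n"

primrec nf_content :: "nf \<Rightarrow> nat multiset" where
  "nf_content Null = {#}"
| "nf_content (Diag e A) = A"
| "nf_content (Mixed A k B) = A + {#k#} + B"

lemma nf_content_mult: "nf_mult a b \<noteq> Null \<Longrightarrow> nf_content (nf_mult a b) = nf_content a + nf_content b"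
  by (cases "(a, b)" rule: nf_mult.cases) (auto split: if_splits)

text \<open>
  The letters of a multilinear monomial are arbitrary apart from using each index in \<open>{1..n}\<close> exactly
  once. For the converse, \<open>u\<close> must choose one letter for every natural number; it is \<open>Y\<close>
  at the indices that do not occur in \<open>xs\<close>.
\<close>

lemma multilinear_letters_iff:
  "(\<exists>\<pi> u. \<pi> permutes {1..n} \<and> (\<forall>i. u i \<in> {Y i, Z i}) \<and> xs = map (\<lambda>i. u (\<pi> i)) [1..<Suc n])
    \<longleftrightarrow> mset (map var_index xs) = mset_set {1..n}"
proof
  assume "\<exists>\<pi> u. \<pi> permutes {1..n} \<and> (\<forall>i. u i \<in> {Y i, Z i}) \<and> xs = map (\<lambda>i. u (\<pi> i)) [1..<Suc n]"
  then obtain \<pi> u where p: "\<pi> permutes {1..n}" and u: "\<And>i. u i \<in> {Y i, Z i}"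
    and xs: "xs = map (\<lambda>i. u (\<pi> i)) [1..<Suc n]" by blast
  have "var_index (u i) = i" for i using u[of i] by auto
  then have "map var_index xs = map \<pi> [1..<Suc n]" by (simp add: xs)
  moreover have "mset [1..<Suc n] = mset_set {1..n}"
    by (metis mset_upt atLeastLessThanSuc_atLeastAtMost)
  ultimately have "mset (map var_index xs) = image_mset \<pi> (mset_set {1..n})"
    by (metis mset_map)
  also have "\<dots> = mset_set (\<pi> ` {1..n})"
    by (rule image_mset_mset_set) (rule permutes_inj_on[OF p])
  finally show "mset (map var_index xs) = mset_set {1..n}"
    by (simp only: permutes_image[OF p])
next
  assume *: "mset (map var_index xs) = mset_set {1..n}"
  define L where "L = map var_index xs"
  have len: "length L = n" by (metis * L_def card_atLeastAtMost diff_Suc_1 size_mset size_mset_set)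
  have set: "set L = {1..n}" by (metis * L_def finite_atLeastAtMost finite_set_mset_mset_set set_mset_mset)
  have dist: "distinct L"
    by (metis card_atLeastAtMost card_distinct diff_Suc_1 len set)
  define \<pi> where "\<pi> i = (if i \<in> {1..n} then L ! (i - 1) else i)" for i
  define u where "u k = (if Z k \<in> set xs then Z k else Y k)" for k
  have nth: "bij_betw ((!) L) {..<n} {1..n}"
    using bij_betw_nth[OF dist _ refl] by (simp add: len set)
  have shift: "bij_betw (\<lambda>i. i - 1) {1..n} {..<n}"
    by (rule bij_betwI[where g = Suc]) auto
  have "bij_betw \<pi> {1..n} {1..n}"
    using bij_betw_trans[OF shift nth] by (rule bij_betw_cong[THEN iffD1, rotated]) (auto simp: \<pi>_def)
  then have p: "\<pi> permutes {1..n}" by (rule bij_imp_permutes) (auto simp: \<pi>_def)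
  have inj: "inj_on var_index (set xs)" using dist by (simp add: L_def distinct_map)
  have u: "u (var_index x) = x" if "x \<in> set xs" for x
  proof (cases x)
    case (Y k)
    have "Z k \<notin> set xs"
      using inj_onD[OF inj, of "Y k" "Z k"] that Y by auto
    then show ?thesis using Y by (simp add: u_def)
  qed (use that in \<open>simp add: u_def\<close>)
  have "xs = map (\<lambda>i. u (\<pi> i)) [1..<Suc n]"
  proof (rule nth_equalityI)
    show "length xs = length (map (\<lambda>i. u (\<pi> i)) [1..<Suc n])" using len by (simp add: L_def)
    fix j assume j: "j < length xs"
    then have "\<pi> (Suc j) = var_index (xs ! j)" using len by (simp add: \<pi>_def L_def)
    then show "xs ! j = map (\<lambda>i. u (\<pi> i)) [1..<Suc n] ! j"
      using j len by (simp add: L_def u del: upt_Suc)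
  qed
  moreover have "\<forall>i. u i \<in> {Y i, Z i}" by (simp add: u_def)
  ultimately show "\<exists>\<pi> u. \<pi> permutes {1..n} \<and> (\<forall>i. u i \<in> {Y i, Z i}) \<and> xs = map (\<lambda>i. u (\<pi> i)) [1..<Suc n]"
    using p by blast
qed

definition multilinear_nfs :: "nat \<Rightarrow> nf set" where
  "multilinear_nfs n = {a. a \<noteq> Null \<and> nf_content a = mset_set {1..n}}"

lemma multilinear_nfs_eq:
  "multilinear_nfs n = range (\<lambda>e. Diag e (mset_set {1..n})) \<union>
    (\<lambda>(k, S). Mixed (mset_set S) k (mset_set ({1..n} - {k} - S))) ` (SIGMA k:{1..n}. Pow ({1..n} - {k}))"
    (is "_ = ?D \<union> ?f ` ?P")
proof
  show "multilinear_nfs n \<subseteq> ?D \<union> ?f ` ?P"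
  proof
    fix a assume a: "a \<in> multilinear_nfs n"
    show "a \<in> ?D \<union> ?f ` ?P"
    proof (cases a)
      case (Mixed A k B)
      let ?S = "set_mset A"
      have c: "count A x + (if x = k then 1 else 0) + count B x = (if x \<in> {1..n} then 1 else 0)" for x
      proof -
        have "count A x + (if x = k then 1 else 0) + count B x = count (nf_content a) x"
          by (simp add: Mixed)
        also have "\<dots> = count (mset_set {1..n}) x" using a by (simp only: multilinear_nfs_def mem_Collect_eq)
        finally show ?thesis by (simp add: count_mset_set')
      qed
      have k: "k \<in> {1..n}" "k \<notin> ?S" using c[of k] by (auto split: if_splits simp: not_in_iff)
      have S: "?S \<subseteq> {1..n} - {k}"
      proof
        fix x assume x: "x \<in> ?S"
        then have "count A x > 0" by simp
        moreover have "x \<notin> {1..n} \<Longrightarrow> count A x = 0" using c[of x] by (auto split: if_splits)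
        ultimately have "x \<in> {1..n}" by (metis less_irrefl)
        then show "x \<in> {1..n} - {k}" using k x by auto
      qed
      have A: "count A x = (if x \<in># A then 1 else 0)" for x
      proof (cases "x \<in># A")
        case True
        then have "count A x > 0" by simp
        moreover have "count A x \<le> 1" using c[of x] by (auto split: if_splits)
        ultimately have "count A x = 1" by linarith
        then show ?thesis using True by simp
      qed (simp add: not_in_iff)
      have "A = mset_set ?S"
        by (rule multiset_eqI) (simp add: A count_mset_set')
      moreover have "B = mset_set ({1..n} - {k} - ?S)"
      proof (rule multiset_eqI)
        show "count B x = count (mset_set ({1..n} - {k} - ?S)) x" for x
          using c[of x] A[of x] by (auto simp: count_mset_set' split: if_splits)
      qed
      ultimately have "a = ?f (k, ?S)" by (simp add: Mixed)
      then show ?thesis using k S by blast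
    qed (use a in \<open>auto simp: multilinear_nfs_def\<close>)
  qed
  show "?D \<union> ?f ` ?P \<subseteq> multilinear_nfs n"
  proof -
    have "mset_set S + {#k#} + mset_set ({1..n} - {k} - S) = mset_set {1..n}"
      if "k \<in> {1..n}" "S \<subseteq> {1..n} - {k}" for k S
      using that finite_subset[OF that(2)]
      by (intro multiset_eqI) (auto simp: count_mset_set')
    then show ?thesis by (auto simp: multilinear_nfs_def)
  qed
qed

lemma card_multilinear_nfs: "card (multilinear_nfs n) = n * 2 ^ (n - 1) + 2"
proof -
  let ?D = "range (\<lambda>e. Diag e (mset_set {1..n}))"
  let ?P = "SIGMA k:{1..n}. Pow ({1..n} - {k})"
  let ?f = "\<lambda>(k, S). Mixed (mset_set S) k (mset_set ({1..n} - {k} - S))"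
  have D: "card ?D = 2" by (subst card_image) (auto intro: injI)
  have inj: "inj_on ?f ?P"
  proof (rule inj_onI)
    fix p q assume pq: "p \<in> ?P" "q \<in> ?P" "?f p = ?f q"
    obtain k S k' S' where eq: "p = (k, S)" "q = (k', S')" by fastforce
    with pq have "finite S" "finite S'" by (auto intro: finite_subset)
    with pq eq show "p = q" by (simp add: mset_set_eq_iff)
  qed
  have "card (?f ` ?P) = card ?P" by (rule card_image[OF inj])
  also have "\<dots> = (\<Sum>k\<in>{1..n}. card (Pow ({1..n} - {k})))"
    by (rule card_SigmaI) auto
  also have "\<dots> = n * 2 ^ (n - 1)" by (simp add: card_Pow)
  finally have P: "card (?f ` ?P) = n * 2 ^ (n - 1)" .
  have "card (?D \<union> ?f ` ?P) = card ?D + card (?f ` ?P)"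
    by (rule card_Un_disjoint) auto
  then show ?thesis by (simp only: multilinear_nfs_eq D P)
qed

context UT2_D_action
begin

lemma nf_content_nf_of: "nf_of m \<noteq> Null \<Longrightarrow> nf_content (nf_of m) = mset (map var_index (letters m))"
proof (induction m)
  case (Unit i x j)
  have idx: "nf_content (nf_idx i) = {#}" for i by (simp add: nf_idx_def)
  have var: "nf_content (nf_var x) = {#var_index x#}" by (cases x) auto
  have "nf_mult (nf_idx i) (nf_var x) \<noteq> Null" using Unit by auto
  then show ?case using Unit by (simp add: nf_content_mult idx var)
next
  case (Step i x m)
  have idx: "nf_content (nf_idx i) = {#}" for i by (simp add: nf_idx_def)
  have var: "nf_content (nf_var x) = {#var_index x#}" by (cases x) auto
  have "nf_mult (nf_idx i) (nf_var x) \<noteq> Null" "nf_of m \<noteq> Null" using Step.prems by auto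
  then show ?case using Step by (simp add: nf_content_mult idx var)
qed

lemma nf_of_word_Y:
  "xs \<noteq> [] \<Longrightarrow> nf_of (word (if e then i1 else i0) (map Y xs)) = Diag e (mset xs)"
proof (induction xs arbitrary: e)
  case (Cons a xs)
  show ?case
    using Cons.IH[of False] i1_neq_i0 by (cases xs) (auto simp: nf_idx_def)
qed simp

lemma nf_of_word_Z: "nf_of (word i0 (map Y xs @ Z k # map Y ys)) = Mixed (mset xs) k (mset ys)"
proof (induction xs)
  case Nil
  show ?case
    using nf_of_word_Y[of ys False] by (cases ys) (auto simp: nf_idx_def)
next
  case (Cons a xs)
  then show ?case by (simp add: word_Cons nf_idx_def)
qed

text \<open>
  The empty product is not a monomial of the free algebra, hence the restriction to \<open>n \<ge> 1\<close>: for \<open>n = 0\<close>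
  the forms \<open>Diag e {#}\<close> are not attained.
\<close>

lemma nf_of_multilinear:
  assumes "n \<ge> 1"
  shows "nf_of ` {m. mset (map var_index (letters m)) = mset_set {1..n}} - {Null} = multilinear_nfs n"
    (is "nf_of ` ?M - {Null} = _")
proof
  show "nf_of ` ?M - {Null} \<subseteq> multilinear_nfs n"
    using nf_content_nf_of by (auto simp: multilinear_nfs_def)
  show "multilinear_nfs n \<subseteq> nf_of ` ?M - {Null}"
  proof
    fix a assume "a \<in> multilinear_nfs n"
    then have a: "a \<noteq> Null" "nf_content a = mset_set {1..n}" by (auto simp: multilinear_nfs_def)
    have "\<exists>m. nf_of m = a"
    proof (cases a)
      case (Diag e A)
      obtain xs where xs: "mset xs = A" using ex_mset by blast
      then have "xs \<noteq> []" using a(2) Diag assms by (auto simp: mset_set_empty_iff)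
      then show ?thesis using nf_of_word_Y xs Diag by blast
    next
      case (Mixed A k B)
      obtain xs ys where "mset xs = A" "mset ys = B" using ex_mset by meson
      then show ?thesis using nf_of_word_Z Mixed by blast
    qed (use a in simp)
    then obtain m where "nf_of m = a" by blast
    then show "a \<in> nf_of ` ?M - {Null}" using a nf_content_nf_of[of m] by auto
  qed
qed

section \<open>Identities and codimensions\<close>

lemma Id_eq_kernel_and_generated:
  shows Id_eq_nf_kernel: "Id_UT2_D \<phi> w = {p. nf_map p = 0}"
    and Id_eq_generated: "Id_UT2_D \<phi> w = T_ideal_generated sW gr w (UT2_D_generators sW w i0 i1)"
proof -
  have ker: "{p. nf_map p = 0} \<subseteq> T_ideal_generated sW gr w (UT2_D_generators sW w i0 i1)"
  proof -
    have "{p. nf_map p = 0} \<subseteq> I"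
      if I: "T_ideal sW gr w I" "UT2_D_generators sW w i0 i1 \<subseteq> I" for I
    proof -
      interpret UT2_D_T_ideal sW gr w i0 \<phi> i1 I by unfold_locales (fact I)+
      show ?thesis using nf_kernel_subset by blast
    qed
    then show ?thesis unfolding T_ideal_generated_def by blast
  qed
  have gen: "T_ideal_generated sW gr w (UT2_D_generators sW w i0 i1) \<subseteq> Id_UT2_D \<phi> w"
    using T_ideal_Id generators_in_Id unfolding T_ideal_generated_def by blast
  have Id: "Id_UT2_D \<phi> w \<subseteq> {p. nf_map p = 0}" using nf_map_Id by blast
  show "Id_UT2_D \<phi> w = {p. nf_map p = 0}" using ker gen Id by blast
  show "Id_UT2_D \<phi> w = T_ideal_generated sW gr w (UT2_D_generators sW w i0 i1)"
    using ker gen Id by blast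
qed

text \<open>
  \<open>nf_map\<close> maps the multilinear elements onto the space spanned by the multilinear normal forms, and
  its kernel there consists of the multilinear identities.
\<close>

lemma codimension_Id:
  assumes "n \<ge> 1"
  shows "codimension (Id_UT2_D \<phi> w) n = n * 2 ^ (n - 1) + 2"
proof -
  interpret c: Vector_Spaces.linear fscale fscale nf_map by (rule linear_nf_map)
  let ?M = "{m :: 'i mono. mset (map var_index (letters m)) = mset_set {1..n}}"
  have mult: "multilinear n = free_space.span (mon ` ?M :: ('i mono \<Rightarrow>\<^sub>0 'f) set)"
    unfolding multilinear_def multilinear_letters_iff by (simp add: image_Collect)
  have "codimension (Id_UT2_D \<phi> w) n = free_space.dim (nf_map ` multilinear n)"
    unfolding codimension_def Id_eq_nf_kernel
    by (rule quotient_dim_linear_image[OF linear_nf_map]) (simp add: mult)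
  also have "nf_map ` multilinear n = free_space.span (nf_map ` mon ` ?M)"
    unfolding mult by (simp only: c.span_image)
  also have "\<dots> = free_space.span (mon ` multilinear_nfs n)"
  proof -
    have "nf_map ` mon ` ?M - {0} = mon ` (nf_of ` ?M - {Null})"
      by (auto simp: image_iff nf_map_mon mon_neq_0 split: if_splits)
    then show ?thesis
      unfolding nf_of_multilinear[OF assms] by (metis free_space.span_delete_0)
  qed
  also have "free_space.dim \<dots> = card (mon ` multilinear_nfs n :: (nf \<Rightarrow>\<^sub>0 'f) set)"
    unfolding free_space.dim_span by (rule free_space.dim_eq_card_independent[OF independent_mon])
  also have "\<dots> = card (multilinear_nfs n)"
    by (rule card_image) (rule inj_on_subset[OF inj_mon subset_UNIV])
  finally show ?thesis by (simp add: card_multilinear_nfs)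
qed

end

theorem theorem5p5:
  fixes sW :: "'f::field_char_0 \<Rightarrow> 'w::ring_1 \<Rightarrow> 'w"
    and gr :: "bit \<Rightarrow> 'w set"
    and \<phi> :: "'w \<Rightarrow> 'f^2^2"
    and w :: "'i \<Rightarrow> 'w"
    and i0 i1 :: 'i
  assumes "z2_graded_algebra sW gr"
    and "unital_graded_hom_UT2 sW gr \<phi>"
    and "range \<phi> = D"
    and "indexed_basis sW w"
    and "w i0 = 1"
    and "\<phi> (w i1) = E 2 2"
    and "\<And>j. j \<noteq> i0 \<Longrightarrow> j \<noteq> i1 \<Longrightarrow> \<phi> (w j) = 0"
  shows "Id_UT2_D \<phi> w = T_ideal_generated sW gr w (UT2_D_generators sW w i0 i1)
    \<and> (\<forall>n\<ge>1. codimension (Id_UT2_D \<phi> w) n = n * 2 ^ (n - 1) + 2)"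
proof -
  interpret z2_graded_algebra sW gr by fact
  interpret UT2_D_action sW gr w i0 \<phi> i1 by unfold_locales (fact assms)+
  show ?thesis using Id_eq_generated codimension_Id by blast
qed

end
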